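(* Let $K$ be a compact line. The following properties are equivalent. (a) $C(K)$ has the regular controlled separable complementation property. (b) $C(K)$ has the controlled separable complementation property. (c) $C(K)$ has the separable complementation property. (d) $K$ is $\aleph_0$-monolithic.
   Context: A compact line is a linearly ordered space that is compact in its order topology. A projection on a Banach space $E$ is a bounded linear operator $P:E\to E$ with $PP=P$; $\operatorname{im}P=\{Px:x\in E\}$ and $P^*:E^*\to E^*$ is the adjoint. $E$ has the separable complementation property (SCP) if for every countable $S\subseteq E$ there is a projection $P$ on $E$ with $S\subseteq\operatorname{im}P$ and $\operatorname{im}P$ separable. $E$ has the controlled SCP if for all countable sets $S\subseteq E$ and $T\subseteq E^*$ there is a projection $P$ on $E$ with $\operatorname{im}P$ separable, $S\subseteq\operatorname{im}P$ and $T\subseteq\operatorname{im}P^*$. For $E=C(K)$, a linear operator $T$ is regular if $T1=1$ and $Tf\ge 0$ whenever $f\ge0$; $C(K)$ has the regular controlled SCP if the projections in the definition of the controlled SCP can always be chosen regular. A compact space $K$ is $\aleph_0$-monolithic if the closure of every countable subset of $K$ is metrizable (second countable). *)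

theory Defs
  imports "HOL-Analysis.Analysis"
begin

text \<open>
  The library states completeness of the space of bounded continuous functions only for a metric
  domain; the domains here are arbitrary compact lines.
\<close>

instance bcontfun :: (topological_space, complete_space) complete_space
proof
  fix X :: "nat \<Rightarrow> 'a \<Rightarrow>\<^sub>C 'b"
  assume cau: "Cauchy X"
  have "uniformly_Cauchy_on UNIV (\<lambda>n. apply_bcontfun (X n))"
    unfolding uniformly_Cauchy_on_def
  proof (intro allI impI)
    fix e :: real
    assume "e > 0"
    then obtain M where "\<forall>m\<ge>M. \<forall>n\<ge>M. dist (X m) (X n) < e"
      using cau unfolding Cauchy_def by blast
    then show "\<exists>M. \<forall>x\<in>UNIV. \<forall>m\<ge>M. \<forall>n\<ge>M. dist (X m x) (X n x) < e"
      by (meson dist_bounded le_less_trans)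
  qed
  then obtain l where l: "uniform_limit UNIV (\<lambda>n. apply_bcontfun (X n)) l sequentially"
    unfolding uniformly_convergent_eq_Cauchy[symmetric] uniformly_convergent_on_def by blast
  obtain l' where "X \<longlonglongrightarrow> l'"
    using uniform_limit_bcontfunE[OF l sequentially_bot] by metis
  then show "convergent X"
    by (auto simp: convergent_def)
qed

instance bcontfun :: (topological_space, banach) banach ..

text \<open>
  A bounded linear operator on \<open>E\<close> is an element of the type \<open>'e \<Rightarrow>\<^sub>L 'e\<close>, and the dual space
  of \<open>E\<close> is the type \<open>'e \<Rightarrow>\<^sub>L real\<close>. (The constant \<open>adjoint\<close> of the library is the Hilbert space
  adjoint, hence the following definition.)
\<close>

definition dual_operator ::
    "('e::banach \<Rightarrow>\<^sub>L 'e) \<Rightarrow> ('e \<Rightarrow>\<^sub>L real) \<Rightarrow> ('e \<Rightarrow>\<^sub>L real)" where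
  "dual_operator P \<phi> = \<phi> o\<^sub>L P"

definition projection :: "('e::banach \<Rightarrow>\<^sub>L 'e) \<Rightarrow> bool" where
  "projection P \<longleftrightarrow> P o\<^sub>L P = P"

definition SCP :: "'e::banach itself \<Rightarrow> bool" where
  "SCP _ \<longleftrightarrow>
    (\<forall>S :: 'e set. countable S \<longrightarrow>
      (\<exists>P :: 'e \<Rightarrow>\<^sub>L 'e. projection P \<and>
        S \<subseteq> range (blinfun_apply P) \<and>
        separable_space (top_of_set (range (blinfun_apply P)))))"

definition controlled_SCP :: "'e::banach itself \<Rightarrow> bool" where
  "controlled_SCP _ \<longleftrightarrow>
    (\<forall>(S :: 'e set) (T :: ('e \<Rightarrow>\<^sub>L real) set). countable S \<longrightarrow> countable T \<longrightarrow>
      (\<exists>P :: 'e \<Rightarrow>\<^sub>L 'e. projection P \<and>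
        separable_space (top_of_set (range (blinfun_apply P))) \<and>
        S \<subseteq> range (blinfun_apply P) \<and>
        T \<subseteq> range (dual_operator P)))"

text \<open>
  For a compact space \<open>K\<close>, given as a type \<open>'k\<close>, every continuous function is bounded, so
  \<open>C(K)\<close> with the supremum norm is the type \<open>'k \<Rightarrow>\<^sub>C real\<close>.
\<close>

definition regular_operator ::
    "(('k::topological_space \<Rightarrow>\<^sub>C real) \<Rightarrow>\<^sub>L ('k \<Rightarrow>\<^sub>C real)) \<Rightarrow> bool" where
  "regular_operator P \<longleftrightarrow>
    blinfun_apply P (const_bcontfun 1) = const_bcontfun 1 \<and>
    (\<forall>f. (\<forall>x. 0 \<le> apply_bcontfun f x) \<longrightarrow>
         (\<forall>x. 0 \<le> apply_bcontfun (blinfun_apply P f) x))"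

definition regular_controlled_SCP :: "'k::topological_space itself \<Rightarrow> bool" where
  "regular_controlled_SCP _ \<longleftrightarrow>
    (\<forall>(S :: ('k \<Rightarrow>\<^sub>C real) set) (T :: (('k \<Rightarrow>\<^sub>C real) \<Rightarrow>\<^sub>L real) set).
      countable S \<longrightarrow> countable T \<longrightarrow>
      (\<exists>P :: ('k \<Rightarrow>\<^sub>C real) \<Rightarrow>\<^sub>L ('k \<Rightarrow>\<^sub>C real). projection P \<and> regular_operator P \<and>
        separable_space (top_of_set (range (blinfun_apply P))) \<and>
        S \<subseteq> range (blinfun_apply P) \<and>
        T \<subseteq> range (dual_operator P)))"

definition aleph0_monolithic :: "'k::topological_space itself \<Rightarrow> bool" where
  "aleph0_monolithic _ \<longleftrightarrow>
    (\<forall>A :: 'k set. countable A \<longrightarrow> metrizable_space (top_of_set (closure A)))"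

end

theory Submission
  imports Defs
begin

text \<open>
  (d) implies (a). A closed set \<open>F\<close> containing both end points of \<open>K\<close> induces a regular
  projection: restrict \<open>f\<close> to \<open>F\<close> and interpolate across every gap of \<open>F\<close> with a Urysohn function.
  Its range is isometric to \<open>C(F)\<close>. It fixes each function that is constant on the nonempty gaps
  of \<open>F\<close>, and its adjoint fixes each functional that kills all functions supported in a gap. By
  compactness, for every function and every functional a countable set meets all intervals on which
  this fails, so \<open>F\<close> can be taken to be the closure of a countable set, which is metrizable by
  monolithicity.

  (c) implies (d). The closure of a countable set \<open>A\<close> is metrizable as soon as it has only countably
  many jumps. Step functions at its jumps behave like the unit vectors of \<open>c\<^sub>0\<close> modulo the closed
  span of countably many functions. If \<open>P\<close> is a projection with separable range fixing the latter, a
  functional of the form \<open>f \<mapsto> (f - P f)(x)\<close> with \<open>x \<in> A\<close> kills all but countably many of the step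
  functions, so uncountably many jumps would give an uncountable separated subset of the range of \<open>P\<close>.
\<close>

section \<open>Partitions of compact lines\<close>

lemma bounded_continuous_on_compact_UNIV:
  fixes f :: "'a::topological_space \<Rightarrow> 'b::metric_space"
  assumes "compact (UNIV :: 'a set)" "continuous_on UNIV f"
  shows "apply_bcontfun (Bcontfun f) = f"
  using assms by (auto intro!: Bcontfun_inverse compact_imp_bounded compact_continuous_image
      simp: bcontfun_def)

lemma compact_t2_Urysohn:
  fixes A B :: "'a::t2_space set"
  assumes "compact (UNIV :: 'a set)" "closed A" "closed B" "A \<inter> B = {}"
  obtains f :: "'a \<Rightarrow> real" where
    "continuous_on UNIV f" "\<And>x. 0 \<le> f x" "\<And>x. f x \<le> 1"
    "\<And>x. x \<in> A \<Longrightarrow> f x = 0" "\<And>x. x \<in> B \<Longrightarrow> f x = 1"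
proof -
  have "normal_space (euclidean :: 'a topology)"
  proof (rule compact_Hausdorff_or_regular_imp_normal_space)
    show "compact_space (euclidean :: 'a topology)"
      using assms(1) by (simp add: compact_space_def)
    show "Hausdorff_space (euclidean :: 'a topology) \<or> regular_space (euclidean :: 'a topology)"
      unfolding Hausdorff_space_def disjnt_def using hausdorff[where 'a = 'a] by simp
  qed
  then obtain f where "continuous_map (euclidean :: 'a topology) (top_of_set {0..1::real}) f"
      "f ` A \<subseteq> {0}" "f ` B \<subseteq> {1}"
    using assms by (auto elim!: Urysohn_lemma[of _ A B 0 1] simp: disjnt_def)
  then show thesis
    by (intro that[of f]) (auto simp: continuous_map_in_subtopology Pi_iff image_subset_iff)
qed

text \<open>Pasting: the closed sets \<open>closure G\<close> and \<open>- G\<close> overlap only in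
  the boundary of \<open>G\<close>, where both formulas give 0. It serves to isolate the part of a
  function inside one gap.\<close>

lemma continuous_on_mult_indicator:
  fixes g :: "'a::topological_space \<Rightarrow> real"
  assumes "continuous_on UNIV g" "open G" "\<And>x. x \<in> closure G - G \<Longrightarrow> g x = 0"
  shows "continuous_on UNIV (\<lambda>x. if x \<in> G then g x else 0)"
proof -
  have "continuous_on (closure G \<union> - G) (\<lambda>x. if x \<in> G then g x else 0)"
    using assms by (intro continuous_on_If) (auto intro: continuous_on_subset)
  moreover have "closure G \<union> - G = UNIV"
    using closure_subset by blast
  ultimately show ?thesis
    by simp
qed

text \<open>
  If the bound \<open>\<epsilon>\<close> failed, one could find functions of norm at most \<open>1\<close> supported in disjoint
  open sets accumulating at \<open>p\<close> with \<open>\<phi>\<close>-values above \<open>\<epsilon>/2\<close>; their sums would contradict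
  the boundedness of \<open>\<phi>\<close>.
\<close>

lemma functional_small_near_point:
  fixes \<phi> :: "('a::topological_space \<Rightarrow>\<^sub>C real) \<Rightarrow>\<^sub>L real"
  assumes K: "compact (UNIV :: 'a set)" and "\<epsilon> > 0"
  obtains V where "open V" "p \<in> V"
    "\<And>f. norm f \<le> 1 \<Longrightarrow> (\<And>x. x \<notin> V - {p} \<Longrightarrow> apply_bcontfun f x = 0) \<Longrightarrow> \<bar>blinfun_apply \<phi> f\<bar> \<le> \<epsilon>"
proof (rule ccontr)
  assume "\<not> thesis"
  with that have neg: "\<exists>f. norm f \<le> 1 \<and> (\<forall>x. x \<notin> V - {p} \<longrightarrow> apply_bcontfun f x = 0)
      \<and> \<not> \<bar>blinfun_apply \<phi> f\<bar> \<le> \<epsilon>" if "open V" "p \<in> V" for V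
    using that by metis
  \<comment> \<open>Truncation at height \<delta> changes the value of the functional by at most
    \<epsilon>/2; the \<open>+ 1\<close> guards against division by zero.\<close>
  define \<delta> where "\<delta> = \<epsilon> / (2 * (norm \<phi> + 1))"
  have \<delta>: "\<delta> > 0" "norm \<phi> * \<delta> \<le> \<epsilon> / 2"
    using \<open>\<epsilon> > 0\<close> by (auto simp: \<delta>_def field_simps add_pos_nonneg)
  have step: "\<exists>g W. open W \<and> p \<in> W \<and> W \<subseteq> V \<and> norm g \<le> 1 \<and>
      (\<forall>x. x \<notin> V - W \<longrightarrow> apply_bcontfun g x = 0) \<and> blinfun_apply \<phi> g \<ge> \<epsilon> / 2"
    if V: "open V" "p \<in> V" for V
  proof -
    obtain f0 where f0: "norm f0 \<le> 1" "\<And>x. x \<notin> V - {p} \<Longrightarrow> apply_bcontfun f0 x = 0"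
        "\<bar>blinfun_apply \<phi> f0\<bar> > \<epsilon>"
      using neg[OF V] by auto
    define f where "f = sgn (blinfun_apply \<phi> f0) *\<^sub>R f0"
    have f: "norm f \<le> 1" "\<And>x. x \<notin> V - {p} \<Longrightarrow> apply_bcontfun f x = 0" "blinfun_apply \<phi> f > \<epsilon>"
      using f0 \<open>\<epsilon> > 0\<close> by (auto simp: f_def blinfun.scaleR_right sgn_real_def split: if_splits)
    define W where "W = V \<inter> {x. \<bar>apply_bcontfun f x\<bar> < \<delta>}"
    have "open {x. \<bar>apply_bcontfun f x\<bar> < \<delta>}"
      by (intro open_Collect_less continuous_intros) auto
    then have W: "open W" "p \<in> W" "W \<subseteq> V"
      using V f(2)[of p] \<delta> by (auto simp: W_def)
    \<comment> \<open>Soft thresholding: \<open>g\<close> vanishes wherever \<open>f\<close> is at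
      most \<delta> in modulus, in particular on the neighbourhood \<open>W\<close> of
      \<open>p\<close>, and stays within \<delta> of \<open>f\<close>.\<close>
    define g where "g = Bcontfun (\<lambda>x. apply_bcontfun f x - max (- \<delta>) (min \<delta> (apply_bcontfun f x)))"
    have g: "apply_bcontfun g x = apply_bcontfun f x - max (- \<delta>) (min \<delta> (apply_bcontfun f x))" for x
      unfolding g_def
      by (subst bounded_continuous_on_compact_UNIV[OF K]) (auto intro!: continuous_intros)
    have f1: "\<bar>apply_bcontfun f x\<bar> \<le> 1" for x
      using norm_bounded[of f x] f(1) by simp
    have "norm g \<le> 1"
    proof (rule norm_bound)
      show "norm (apply_bcontfun g x) \<le> 1" for x
        using f1[of x] \<delta> by (auto simp: g max_def min_def)
    qed
    moreover have "\<forall>x. x \<notin> V - W \<longrightarrow> apply_bcontfun g x = 0"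
    proof (intro allI impI)
      fix x assume "x \<notin> V - W"
      then show "apply_bcontfun g x = 0"
        using f(2)[of x] \<delta> by (cases "x \<in> V") (auto simp: g W_def max_def min_def)
    qed
    moreover have "norm (f - g) \<le> \<delta>"
    proof (rule norm_bound)
      show "norm (apply_bcontfun (f - g) x) \<le> \<delta>" for x
        using \<delta> by (auto simp: g max_def min_def)
    qed
    then have "\<bar>blinfun_apply \<phi> (f - g)\<bar> \<le> \<epsilon> / 2"
      using norm_blinfun[of \<phi> "f - g"] \<delta> mult_left_mono[of "norm (f-g)" \<delta> "norm \<phi>"] by simp
    then have "blinfun_apply \<phi> g \<ge> \<epsilon> / 2"
      using f(3) unfolding blinfun.diff_right by linarith
    ultimately show ?thesis
      using W by blast
  qed
  have many: "\<exists>g. norm g \<le> 1 \<and> (\<forall>x. x \<notin> V \<longrightarrow> apply_bcontfun g x = 0) \<and> blinfun_apply \<phi> g \<ge> real n * (\<epsilon> / 2)"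
    if "open V" "p \<in> V" for n V
    using that
  proof (induction n arbitrary: V)
    case 0
    then show ?case
      by (intro exI[of _ 0]) auto
  next
    case (Suc n)
    obtain g W where W: "open W" "p \<in> W" "W \<subseteq> V" and g: "norm g \<le> 1"
        "\<And>x. x \<notin> V - W \<Longrightarrow> apply_bcontfun g x = 0" "blinfun_apply \<phi> g \<ge> \<epsilon> / 2"
      using step[OF Suc.prems] by blast
    \<comment> \<open>The remaining \<open>n\<close> bumps are packed into \<open>W\<close>, where
      \<open>g\<close> vanishes, so the sum still has norm at most 1.\<close>
    obtain h where h: "norm h \<le> 1" "\<And>x. x \<notin> W \<Longrightarrow> apply_bcontfun h x = 0"
        "blinfun_apply \<phi> h \<ge> real n * (\<epsilon> / 2)"
      using Suc.IH[OF W(1,2)] by blast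
    have "norm (g + h) \<le> 1"
    proof (rule norm_bound)
      show "norm (apply_bcontfun (g + h) x) \<le> 1" for x
        using norm_bounded[of g x] norm_bounded[of h x] g(1) h(1) g(2)[of x] h(2)[of x] W(3)
        by (cases "x \<in> W") auto
    qed
    then show ?case
      using g h W by (intro exI[of _ "g + h"]) (auto simp: blinfun.add_right algebra_simps)
  qed
  have bd: "real n * (\<epsilon> / 2) \<le> norm \<phi>" for n
  proof -
    obtain g where g: "norm g \<le> 1" "blinfun_apply \<phi> g \<ge> real n * (\<epsilon> / 2)"
      using many[of UNIV n] by auto
    then show ?thesis
      using norm_blinfun[of \<phi> g] mult_left_mono[of "norm g" 1 "norm \<phi>"] by simp
  qed
  obtain n where "norm \<phi> < real n * (\<epsilon> / 2)"
    using reals_Archimedean3[of "\<epsilon> / 2"] \<open>\<epsilon> > 0\<close> by auto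
  with bd[of n] show False
    by simp
qed

section \<open>Cutting a compact line into intervals with a prescribed property\<close>

text \<open>Induction along the line: the points up to which some finite set works have a supremum
  \<open>s\<close> by compactness; \<open>s\<close> is reached, and nothing lies beyond it. The
  local hypothesis speaks only of intervals ending at \<open>s\<close>, since a functional may have
  an atom at \<open>s\<close>.\<close>

lemma compact_line_partition:
  fixes N :: "'k::linorder_topology \<Rightarrow> 'k \<Rightarrow> bool"
  assumes K: "compact (UNIV :: 'k set)"
    and mono: "\<And>a b c d. N a d \<Longrightarrow> a \<le> b \<Longrightarrow> b < c \<Longrightarrow> c \<le> d \<Longrightarrow> N b c"
    and empty: "\<And>a b. a < b \<Longrightarrow> {a<..<b} = {} \<Longrightarrow> N a b"
    and loc: "\<And>s. \<exists>V. open V \<and> s \<in> V \<and> (\<forall>a b. a < b \<longrightarrow> a = s \<or> b = s \<longrightarrow> {a..b} \<subseteq> V \<longrightarrow> N a b)"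
  obtains F where "finite F" "\<And>a b. a < b \<Longrightarrow> {a<..<b} \<inter> F = {} \<Longrightarrow> N a b"
proof -
  define good where "good F x \<longleftrightarrow> finite F \<and> (\<forall>a b. a < b \<longrightarrow> b \<le> x \<longrightarrow> {a<..<b} \<inter> F = {} \<longrightarrow> N a b)"
    for F x
  define Q where "Q = {x. \<exists>F. good F x}"
  have down: "y \<in> Q" if "x \<in> Q" "y \<le> x" for x y
    using that by (force simp: Q_def good_def)
  have extend: "t \<in> Q" if "s \<in> Q" "s < t" "N s t" for s t
  proof -
    obtain F where F: "good F s"
      using \<open>s \<in> Q\<close> by (auto simp: Q_def)
    \<comment> \<open>An interval whose interior avoids \<open>s\<close> lies below \<open>s\<close>
      or inside \<open>[s, t]\<close>; the first kind is settled by \<open>F\<close>, the second by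
      monotonicity of \<open>N\<close>.\<close>
    have "N a b" if ab: "a < b" "b \<le> t" "{a<..<b} \<inter> insert s F = {}" for a b
    proof (cases "b \<le> s")
      case True
      then show ?thesis
        using F ab by (auto simp: good_def)
    next
      case False
      then have "s \<le> a"
        using ab by force
      then show ?thesis
        using mono[OF \<open>N s t\<close>] ab by blast
    qed
    then have "good (insert s F) t"
      using F by (auto simp: good_def)
    then show ?thesis
      by (auto simp: Q_def)
  qed
  obtain m :: 'k where m: "\<And>x. m \<le> x"
    using compact_attains_inf[OF K] by auto
  have "good {} m"
    using m by (auto simp: good_def) (meson leD order_trans)
  then have "closure Q \<noteq> {}"
    by (auto simp: Q_def)
  moreover have "compact (closure Q)"
    using K by (metis closed_Int_compact closed_closure inf_top_right)
  \<comment> \<open>Compactness replaces order completeness: the supremum of \<open>Q\<close> is the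
    maximum of its closure.\<close>
  ultimately obtain s where s: "s \<in> closure Q" "\<And>x. x \<in> closure Q \<Longrightarrow> x \<le> s"
    using compact_attains_sup[of "closure Q"] by auto
  have below: "x \<in> Q" if "x < s" for x
  proof -
    have "\<exists>y\<in>Q. x < y"
      using s(1) that open_Int_closure_eq_empty[OF open_greaterThan[of x], of Q] by auto
    then show ?thesis
      using down by auto
  qed
  obtain V where V: "open V" "s \<in> V" "\<And>a b. a < b \<Longrightarrow> a = s \<or> b = s \<Longrightarrow> {a..b} \<subseteq> V \<Longrightarrow> N a b"
    using loc[of s] by auto
  \<comment> \<open>Either \<open>s\<close> has an immediate predecessor and \<open>empty\<close>
    bridges the jump, or some interval ending at \<open>s\<close> lies in \<open>V\<close>. At the
    minimum of the line the empty set works.\<close>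
  have "s \<in> Q"
  proof (cases "\<exists>u. u < s")
    case True
    then obtain c where c: "c < s" "{c<..s} \<subseteq> V"
      using open_left[OF V(1,2)] by auto
    show ?thesis
    proof (cases "{c<..<s} = {}")
      case True
      then show ?thesis
        using extend[OF below, of c s] c empty[of c s] by auto
    next
      case False
      then obtain u where u: "c < u" "u < s"
        by auto
      then have "N u s"
        using c by (intro V(3)) (auto simp: subset_iff)
      then show ?thesis
        using extend[OF below, of u s] u by auto
    qed
  next
    case False
    then have "s = m"
      using m[of s] by (metis order_le_less)
    then show ?thesis
      using \<open>good {} m\<close> by (auto simp: Q_def)
  qed
  \<comment> \<open>By the same alternative on the right of \<open>s\<close>, a larger point would
    lead to a point of \<open>Q\<close> above the maximum of its closure.\<close>
  have "x \<le> s" for x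
  proof (rule ccontr)
    assume "\<not> x \<le> s"
    then obtain c where c: "s < c" "{s..<c} \<subseteq> V"
      using open_right[OF V(1,2), of x] by (metis not_le)
    have "\<exists>t>s. N s t"
    proof (cases "{s<..<c} = {}")
      case True
      then show ?thesis
        using c empty[of s c] by auto
    next
      case False
      then obtain u where u: "s < u" "u < c"
        by auto
      then have "N s u"
        using c by (intro V(3)) (auto simp: subset_iff)
      then show ?thesis
        using u by auto
    qed
    then obtain t where "s < t" "t \<in> Q"
      using extend[OF \<open>s \<in> Q\<close>] by auto
    then show False
      using s(2)[of t] closure_subset[of Q] by auto
  qed
  moreover obtain F where "good F s"
    using \<open>s \<in> Q\<close> unfolding Q_def by blast
  ultimately show thesis
    by (intro that[of F]) (auto simp: good_def)
qed


text \<open>For each \<epsilon> = 1/(n+1) a finite set bounds the oscillation on the intervals it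
  cuts out; on an interval missing all these sets the oscillation is zero.\<close>

lemma continuous_function_partition:
  fixes f :: "'k::linorder_topology \<Rightarrow> real"
  assumes K: "compact (UNIV :: 'k set)" and f: "continuous_on UNIV f"
  obtains A where "countable A"
    "\<And>a b u v. {a<..<b} \<inter> A = {} \<Longrightarrow> {a<..<b} \<noteq> {} \<Longrightarrow> u \<in> {a..b} \<Longrightarrow> v \<in> {a..b} \<Longrightarrow> f u = f v"
proof -
  \<comment> \<open>Intervals with empty interior are exempt, because \<open>f\<close> may take
    different values at two adjacent points.\<close>
  define N where "N \<epsilon> a b \<longleftrightarrow> {a<..<b} = {} \<or> (\<forall>u\<in>{a..b}. \<forall>v\<in>{a..b}. \<bar>f u - f v\<bar> \<le> \<epsilon>)" for \<epsilon> a b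
  have "\<exists>F. finite F \<and> (\<forall>a b. a < b \<longrightarrow> {a<..<b} \<inter> F = {} \<longrightarrow> N \<epsilon> a b)" if "\<epsilon> > 0" for \<epsilon>
  proof (rule compact_line_partition[OF K, of "N \<epsilon>"])
    show "N \<epsilon> b c" if "N \<epsilon> a d" "a \<le> b" "b < c" "c \<le> d" for a b c d
    proof -
      have "{b<..<c} \<subseteq> {a<..<d}" "{b..c} \<subseteq> {a..d}"
        using that by auto
      then show ?thesis
        using that(1) unfolding N_def by blast
    qed
    show "\<exists>V. open V \<and> s \<in> V \<and> (\<forall>a b. a < b \<longrightarrow> a = s \<or> b = s \<longrightarrow> {a..b} \<subseteq> V \<longrightarrow> N \<epsilon> a b)" for s
    proof (intro exI[of _ "{x. \<bar>f x - f s\<bar> < \<epsilon> / 2}"] conjI allI impI)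
      show "open {x. \<bar>f x - f s\<bar> < \<epsilon> / 2}"
        by (intro open_Collect_less continuous_intros f)
      fix a b assume ab: "{a..b} \<subseteq> {x. \<bar>f x - f s\<bar> < \<epsilon> / 2}"
      have "\<bar>f u - f v\<bar> \<le> \<epsilon>" if "u \<in> {a..b}" "v \<in> {a..b}" for u v
        using subsetD[OF ab that(1)] subsetD[OF ab that(2)] by (simp add: abs_if split: if_splits)
      then show "N \<epsilon> a b"
        by (auto simp: N_def)
    qed (use \<open>\<epsilon> > 0\<close> in auto)
  qed (auto simp: N_def)
  then have "\<exists>F. finite F \<and> (\<forall>a b. a < b \<longrightarrow> {a<..<b} \<inter> F = {} \<longrightarrow> N (1 / Suc n) a b)" for n
    by simp
  then obtain F where F: "\<And>n. finite (F n)"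
      "\<And>n a b. a < b \<Longrightarrow> {a<..<b} \<inter> F n = {} \<Longrightarrow> N (1 / Suc n) a b"
    by metis
  show thesis
  proof (rule that[of "\<Union>n. F n"])
    show "countable (\<Union>n. F n)"
      using F(1) by (auto intro: countable_finite)
    fix a b u v
    assume *: "{a<..<b} \<inter> (\<Union>n. F n) = {}" "{a<..<b} \<noteq> {}" "u \<in> {a..b}" "v \<in> {a..b}"
    then have "a < b" by force
    have "\<bar>f u - f v\<bar> \<le> 1 / Suc n" for n
    proof -
      have "N (1 / Suc n) a b"
        using \<open>a < b\<close> * by (intro F(2)) auto
      then show ?thesis
        using * unfolding N_def by blast
    qed
    then have "\<bar>f u - f v\<bar> \<le> 0"
      by (meson nat_approx_posE not_le)
    then show "f u = f v"
      by simp
  qed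
qed

text \<open>Same scheme, with the variation of the functional on an open interval in place of the
  oscillation. In terms of the representing measure, open intervals missing \<open>A\<close> are
  null sets.\<close>

lemma functional_partition:
  fixes \<phi> :: "('k::linorder_topology \<Rightarrow>\<^sub>C real) \<Rightarrow>\<^sub>L real"
  assumes K: "compact (UNIV :: 'k set)"
  obtains A where "countable A"
    "\<And>a b f. {a<..<b} \<inter> A = {} \<Longrightarrow> (\<And>x. x \<notin> {a<..<b} \<Longrightarrow> apply_bcontfun f x = 0)
      \<Longrightarrow> blinfun_apply \<phi> f = 0"
proof -
  define N where "N \<epsilon> a b \<longleftrightarrow> (\<forall>f. norm f \<le> 1 \<longrightarrow> (\<forall>x. x \<notin> {a<..<b} \<longrightarrow> apply_bcontfun f x = 0)
      \<longrightarrow> \<bar>blinfun_apply \<phi> f\<bar> \<le> \<epsilon>)" for \<epsilon> a b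
  have "\<exists>F. finite F \<and> (\<forall>a b. a < b \<longrightarrow> {a<..<b} \<inter> F = {} \<longrightarrow> N \<epsilon> a b)" if "\<epsilon> > 0" for \<epsilon>
  proof (rule compact_line_partition[OF K, of "N \<epsilon>"])
    show "N \<epsilon> b c" if "N \<epsilon> a d" "a \<le> b" "b < c" "c \<le> d" for a b c d
    proof -
      have "{b<..<c} \<subseteq> {a<..<d}"
        using that by auto
      then show ?thesis
        using that(1) unfolding N_def by blast
    qed
    show "N \<epsilon> a b" if "a < b" "{a<..<b} = {}" for a b
    proof -
      have "f = 0" if "\<forall>x. x \<notin> {a<..<b} \<longrightarrow> apply_bcontfun f x = 0" for f :: "'k \<Rightarrow>\<^sub>C real"
        using that \<open>{a<..<b} = {}\<close> by (auto intro: bcontfun_eqI)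
      then show ?thesis
        using \<open>\<epsilon> > 0\<close> by (force simp: N_def)
    qed
    show "\<exists>V. open V \<and> s \<in> V \<and> (\<forall>a b. a < b \<longrightarrow> a = s \<or> b = s \<longrightarrow> {a..b} \<subseteq> V \<longrightarrow> N \<epsilon> a b)" for s
    proof -
      obtain V where V: "open V" "s \<in> V"
        "\<And>f. norm f \<le> 1 \<Longrightarrow> (\<And>x. x \<notin> V - {s} \<Longrightarrow> apply_bcontfun f x = 0) \<Longrightarrow> \<bar>blinfun_apply \<phi> f\<bar> \<le> \<epsilon>"
        using functional_small_near_point[OF K \<open>\<epsilon> > 0\<close>] by blast
      have "N \<epsilon> a b" if "a = s \<or> b = s" "{a..b} \<subseteq> V" for a b
      proof -
        have "{a<..<b} \<subseteq> {a..b} - {s}"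
          using that by auto
        then have "{a<..<b} \<subseteq> V - {s}"
          using that by blast
        then show ?thesis
          unfolding N_def by (metis V(3) subsetD)
      qed
      then show ?thesis
        using V(1,2) by blast
    qed
  qed auto
  then have "\<exists>F. finite F \<and> (\<forall>a b. a < b \<longrightarrow> {a<..<b} \<inter> F = {} \<longrightarrow> N (1 / Suc n) a b)" for n
    by simp
  then obtain F where F: "\<And>n. finite (F n)"
      "\<And>n a b. a < b \<Longrightarrow> {a<..<b} \<inter> F n = {} \<Longrightarrow> N (1 / Suc n) a b"
    by metis
  show thesis
  proof (rule that[of "\<Union>n. F n"])
    show "countable (\<Union>n. F n)"
      using F(1) by (auto intro: countable_finite)
    fix a b and f :: "'k \<Rightarrow>\<^sub>C real"
    assume *: "{a<..<b} \<inter> (\<Union>n. F n) = {}" and f: "\<And>x. x \<notin> {a<..<b} \<Longrightarrow> apply_bcontfun f x = 0"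
    show "blinfun_apply \<phi> f = 0"
    proof (cases "a < b \<and> f \<noteq> 0")
      case True
      have "\<bar>blinfun_apply \<phi> (f /\<^sub>R norm f)\<bar> \<le> 1 / Suc n" for n
      proof -
        have "N (1 / Suc n) a b"
          using True * by (intro F(2)) auto
        moreover have "norm (f /\<^sub>R norm f) \<le> 1"
          using True by simp
        moreover have "\<forall>x. x \<notin> {a<..<b} \<longrightarrow> apply_bcontfun (f /\<^sub>R norm f) x = 0"
          using f by simp
        ultimately show ?thesis
          unfolding N_def by blast
      qed
      then have "\<bar>blinfun_apply \<phi> (f /\<^sub>R norm f)\<bar> \<le> 0"
        by (meson nat_approx_posE not_le)
      then show ?thesis
        using True by (simp add: blinfun.scaleR_right)
    next
      case False
      then have "apply_bcontfun f x = 0" for x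
        using f[of x] by (cases "f = 0") auto
      then have "f = 0"
        by (intro bcontfun_eqI) simp
      then show ?thesis
        by simp
    qed
  qed
qed

text \<open>One point from each small set gives a countable dense set. This reduces separability to
  counting sets of approximants.\<close>

lemma separable_space_countable_cover:
  fixes X :: "'a::metric_space set"
  assumes cover: "\<And>e. e > 0 \<Longrightarrow>
    \<exists>\<C>. countable \<C> \<and> X \<subseteq> \<Union>\<C> \<and> (\<forall>C\<in>\<C>. \<forall>x\<in>C \<inter> X. \<forall>y\<in>C \<inter> X. dist x y < e)"
  shows "separable_space (top_of_set X)"
proof -
  define small where "small e \<C> \<longleftrightarrow>
      countable \<C> \<and> X \<subseteq> \<Union>\<C> \<and> (\<forall>C\<in>\<C>. \<forall>x\<in>C \<inter> X. \<forall>y\<in>C \<inter> X. dist x y < e)" for e \<C>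
  have "\<forall>n. \<exists>\<C>. small (1 / Suc n) \<C>"
    unfolding small_def by (intro allI cover) simp
  then obtain \<C> where "\<And>n. small (1 / Suc n) (\<C> n)"
    by metis
  then have \<C>: "\<And>n. countable (\<C> n)" "\<And>n. X \<subseteq> \<Union>(\<C> n)"
      "\<And>n C x y. C \<in> \<C> n \<Longrightarrow> x \<in> C \<Longrightarrow> x \<in> X \<Longrightarrow> y \<in> C \<Longrightarrow> y \<in> X \<Longrightarrow> dist x y < 1 / Suc n"
    unfolding small_def by simp_all
  \<comment> \<open>For \<open>C\<close> disjoint from \<open>X\<close> the chosen point is
    arbitrary; the intersection in \<open>D\<close> keeps only points of \<open>X\<close>.\<close>
  define p where "p C = (SOME x. x \<in> C \<inter> X)" for C
  define D where "D = X \<inter> (\<Union>n. p ` \<C> n)"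
  have "X \<subseteq> closure D"
  proof
    fix x assume "x \<in> X"
    show "x \<in> closure D"
      unfolding closure_approachable
    proof (intro allI impI)
      fix e :: real assume "e > 0"
      then obtain n where n: "1 / Suc n < e"
        using nat_approx_posE[OF \<open>e > 0\<close>] by blast
      obtain C where C: "C \<in> \<C> n" "x \<in> C"
        using subsetD[OF \<C>(2) \<open>x \<in> X\<close>] by (rule UnionE)
      then have pC: "p C \<in> C" "p C \<in> X"
        using someI[of "\<lambda>x. x \<in> C \<inter> X" x] \<open>x \<in> X\<close> by (simp_all add: p_def)
      have "dist (p C) x < e"
        using \<C>(3)[OF C(1) pC C(2) \<open>x \<in> X\<close>] n by linarith
      moreover have "p C \<in> D"
        using C(1) pC(2) unfolding D_def by blast
      ultimately show "\<exists>y\<in>D. dist y x < e"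
        by blast
    qed
  qed
  moreover have "D \<subseteq> X"
    by (simp add: D_def)
  moreover have "countable (\<Union>n. p ` \<C> n)"
    using \<C>(1) by (intro countable_UN countable_image) auto
  then have "countable D"
    unfolding D_def by (rule countable_Int2)
  ultimately show ?thesis
    unfolding separable_space_def
    by (intro exI[of _ D]) (simp add: closure_of_subtopology Int_absorb1 Int_absorb2)
qed

section \<open>Interpolation across the gaps of a closed set\<close>

text \<open>A Urysohn function chosen once for each pair, so that interpolation with it is linear in
  the interpolated values. For pairs without \<open>a < b\<close> the choice is arbitrary.\<close>

definition step_function :: "'k::linorder_topology \<Rightarrow> 'k \<Rightarrow> ('k \<Rightarrow>\<^sub>C real)" where
  "step_function a b = (SOME h. (\<forall>x. 0 \<le> apply_bcontfun h x \<and> apply_bcontfun h x \<le> 1) \<and>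
      (\<forall>x\<le>a. apply_bcontfun h x = 0) \<and> (\<forall>x\<ge>b. apply_bcontfun h x = 1))"

lemma step_function:
  fixes a b :: "'k::linorder_topology"
  assumes K: "compact (UNIV :: 'k set)" and "a < b"
  shows "0 \<le> apply_bcontfun (step_function a b) x" "apply_bcontfun (step_function a b) x \<le> 1"
    "x \<le> a \<Longrightarrow> apply_bcontfun (step_function a b) x = 0"
    "b \<le> x \<Longrightarrow> apply_bcontfun (step_function a b) x = 1"
proof -
  have "{..a} \<inter> {b..} = {}"
    using \<open>a < b\<close> by auto
  then obtain f :: "'k \<Rightarrow> real" where f: "continuous_on UNIV f" "\<And>x. 0 \<le> f x" "\<And>x. f x \<le> 1"
      "\<And>x. x \<in> {..a} \<Longrightarrow> f x = 0" "\<And>x. x \<in> {b..} \<Longrightarrow> f x = 1"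
    using compact_t2_Urysohn[OF K closed_atMost[of a] closed_atLeast[of b]] by metis
  have "\<exists>h :: 'k \<Rightarrow>\<^sub>C real. (\<forall>x. 0 \<le> apply_bcontfun h x \<and> apply_bcontfun h x \<le> 1) \<and>
      (\<forall>x\<le>a. apply_bcontfun h x = 0) \<and> (\<forall>x\<ge>b. apply_bcontfun h x = 1)"
    by (rule exI[of _ "Bcontfun f"])
      (use f(2-) in \<open>simp add: bounded_continuous_on_compact_UNIV[OF K f(1)]\<close>)
  from someI_ex[OF this, folded step_function_def]
  show "0 \<le> apply_bcontfun (step_function a b) x" "apply_bcontfun (step_function a b) x \<le> 1"
    "x \<le> a \<Longrightarrow> apply_bcontfun (step_function a b) x = 0"
    "b \<le> x \<Longrightarrow> apply_bcontfun (step_function a b) x = 1"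
    by auto
qed

text \<open>The end points of the line belong to \<open>F\<close>, so every point off
  \<open>F\<close> lies in a gap with both ends in \<open>F\<close>.\<close>

locale compact_line_subset =
  fixes F :: "'k::linorder_topology set"
  assumes compact: "compact (UNIV :: 'k set)"
    and closed: "closed F"
    and bot_ex: "\<exists>m\<in>F. \<forall>x. m \<le> x"
    and top_ex: "\<exists>m\<in>F. \<forall>x. x \<le> m"
begin

definition lo :: "'k \<Rightarrow> 'k" where
  "lo x = (SOME y. y \<in> F \<and> y \<le> x \<and> (\<forall>z\<in>F. z \<le> x \<longrightarrow> z \<le> y))"

definition hi :: "'k \<Rightarrow> 'k" where
  "hi x = (SOME y. y \<in> F \<and> x \<le> y \<and> (\<forall>z\<in>F. x \<le> z \<longrightarrow> y \<le> z))"

lemma compact_Int_closed_set: "closed S \<Longrightarrow> compact (F \<inter> S)"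
  using compact closed closed_Int_compact[of "F \<inter> S" UNIV] by (simp add: closed_Int)

lemma lo: "lo x \<in> F" "lo x \<le> x" "z \<in> F \<Longrightarrow> z \<le> x \<Longrightarrow> z \<le> lo x"
proof -
  have "F \<inter> {..x} \<noteq> {}"
    using bot_ex by auto
  then have "\<exists>y. y \<in> F \<and> y \<le> x \<and> (\<forall>z\<in>F. z \<le> x \<longrightarrow> z \<le> y)"
    using compact_attains_sup[OF compact_Int_closed_set[OF closed_atMost[of x]]] by auto
  from someI_ex[OF this, folded lo_def]
  show "lo x \<in> F" "lo x \<le> x" "z \<in> F \<Longrightarrow> z \<le> x \<Longrightarrow> z \<le> lo x"
    by auto
qed

lemma hi: "hi x \<in> F" "x \<le> hi x" "z \<in> F \<Longrightarrow> x \<le> z \<Longrightarrow> hi x \<le> z"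
proof -
  have "F \<inter> {x..} \<noteq> {}"
    using top_ex by auto
  then have "\<exists>y. y \<in> F \<and> x \<le> y \<and> (\<forall>z\<in>F. x \<le> z \<longrightarrow> y \<le> z)"
    using compact_attains_inf[OF compact_Int_closed_set[OF closed_atLeast[of x]]] by auto
  from someI_ex[OF this, folded hi_def]
  show "hi x \<in> F" "x \<le> hi x" "z \<in> F \<Longrightarrow> x \<le> z \<Longrightarrow> hi x \<le> z"
    by auto
qed

lemma lo_hi_mem: "x \<in> F \<Longrightarrow> lo x = x" "x \<in> F \<Longrightarrow> hi x = x"
  using lo[of x] hi[of x] by (auto intro!: antisym)

lemma lo_hi_gap:
  assumes "a \<in> F" "b \<in> F" "{a<..<b} \<inter> F = {}" "x \<in> {a<..<b}"
  shows "lo x = a" "hi x = b"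
proof -
  have x: "a < x" "x < b"
    using assms(4) by auto
  have "lo x < b" "a < hi x"
    using lo(2)[of x] hi(2)[of x] x by order+
  then have "\<not> a < lo x" "\<not> hi x < b"
    using assms(3) lo(1)[of x] hi(1)[of x] by auto
  moreover have "a \<le> lo x" "hi x \<le> b"
    using lo(3)[OF assms(1)] hi(3)[OF assms(2)] x by simp_all
  ultimately show "lo x = a" "hi x = b"
    by order+
qed

lemma lo_hi_notin:
  assumes "x \<notin> F"
  shows "x \<in> {lo x<..<hi x}" "{lo x<..<hi x} \<inter> F = {}"
proof -
  show "x \<in> {lo x<..<hi x}"
    using lo(1,2)[of x] hi(1,2)[of x] assms by (auto simp: less_le)
  show "{lo x<..<hi x} \<inter> F = {}"
    using lo(3)[of _ x] hi(3)[of _ x] by (force simp: not_le disjoint_iff dest: leD)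
qed

text \<open>On \<open>F\<close> both neighbours are \<open>x\<close> itself and the second summand
  is 0, whatever \<open>step_function x x\<close> is.\<close>

definition gap_extension :: "('k \<Rightarrow> real) \<Rightarrow> 'k \<Rightarrow> real" where
  "gap_extension f x = f (lo x) + apply_bcontfun (step_function (lo x) (hi x)) x * (f (hi x) - f (lo x))"

lemma gap_extension_mem [simp]: "x \<in> F \<Longrightarrow> gap_extension f x = f x"
  by (simp add: gap_extension_def lo_hi_mem)

text \<open>One convexity statement serves for the norm bound (balls around 0), for positivity
  (\<open>{0..}\<close>) and for continuity (small balls).\<close>

lemma gap_extension_convex:
  assumes "convex C" "f (lo x) \<in> C" "f (hi x) \<in> C"
  shows "gap_extension f x \<in> C"
proof (cases "x \<in> F")
  case True
  then show ?thesis
    using assms by (simp add: lo_hi_mem)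
next
  case False
  then have less: "lo x < hi x"
    using lo_hi_notin(1)[of x] by auto
  define t where "t = apply_bcontfun (step_function (lo x) (hi x)) x"
  have "(1 - t) *\<^sub>R f (lo x) + t *\<^sub>R f (hi x) \<in> C"
    using assms step_function(1,2)[OF compact less, of x]
    by (intro convexD) (auto simp: t_def)
  then show ?thesis
    by (simp add: gap_extension_def t_def algebra_simps)
qed

text \<open>If a gap starts at \<open>x\<close>, the extension is given there by one continuous
  formula. Otherwise \<open>F\<close> accumulates at \<open>x\<close> from the right, which forces
  \<open>lo y\<close> and \<open>hi y\<close> to tend to \<open>x\<close> with
  \<open>y\<close>.\<close>

lemma gap_extension_tendsto_right:
  assumes f: "continuous_on UNIV f" and "x \<in> F"
  shows "(gap_extension f \<longlongrightarrow> f x) (at_right x)"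
proof (cases "\<exists>c. x < c")
  case False
  then have "{x<..} = {}"
    by auto
  then show ?thesis
    by simp
next
  case True
  then obtain c0 where "x < c0" by auto
  show ?thesis
  proof (cases "\<exists>c>x. {x<..<c} \<inter> F = {}")
    case True
    then obtain c where c: "x < c" "{x<..<c} \<inter> F = {}" by auto
    \<comment> \<open>The gap may reach beyond \<open>c\<close>, which need not lie in
      \<open>F\<close>; \<open>b\<close> is its true right end.\<close>
    define b where "b = hi c"
    have "x < b" "b \<in> F"
      using c(1) hi(1,2)[of c] by (auto simp: b_def)
    moreover have "z \<notin> F" if "x < z" "z < b" for z
      using c(2) hi(3)[of z c] that by (cases "z < c") (auto simp: b_def disjoint_iff not_less)
    ultimately have b: "b \<in> F" "x < b" "{x<..<b} \<inter> F = {}"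
      by (auto simp: disjoint_iff)
    define g where "g y = f x + apply_bcontfun (step_function x b) y * (f b - f x)" for y
    have "continuous_on UNIV g"
      unfolding g_def by (intro continuous_intros) auto
    then have "(g \<longlongrightarrow> g x) (at_right x)"
      by (auto simp: continuous_on_def intro: tendsto_within_subset)
    moreover have "g x = f x"
      using step_function(3)[OF compact b(2)] by (simp add: g_def)
    moreover have "eventually (\<lambda>y. g y = gap_extension f y) (at_right x)"
      unfolding eventually_at_right[OF b(2)] using b lo_hi_gap[OF \<open>x \<in> F\<close> b(1,3)]
      by (intro exI[of _ b]) (simp add: gap_extension_def g_def)
    ultimately show ?thesis
      by (simp add: tendsto_cong)
  next
    case False
    show ?thesis
    proof (rule tendstoI)
      fix e :: real assume "e > 0"
      have "open (f -` ball (f x) e)"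
        using f by (simp add: open_vimage)
      then obtain c where c: "x < c" "{x..<c} \<subseteq> f -` ball (f x) e"
        using open_right[OF _ _ \<open>x < c0\<close>, of "f -` ball (f x) e"] \<open>e > 0\<close> by auto
      then have "{x<..<c} \<inter> F \<noteq> {}"
        using False by blast
      \<comment> \<open>A point \<open>z\<close> of \<open>F\<close> inside the neighbourhood traps
        \<open>lo y\<close> and \<open>hi y\<close> between \<open>x\<close> and
        \<open>z\<close>.\<close>
      then obtain z where z: "x < z" "z < c" "z \<in> F"
        by auto
      have "dist (gap_extension f y) (f x) < e" if "x < y" "y < z" for y
      proof -
        have "x \<le> lo y" "lo y < c" "x \<le> hi y" "hi y < c"
          using lo(2)[of y] lo(3)[OF \<open>x \<in> F\<close> less_imp_le[OF that(1)]] hi(2)[of y]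
            hi(3)[OF z(3) less_imp_le[OF that(2)]] that z(1,2) by order+
        then have "f (lo y) \<in> ball (f x) e" "f (hi y) \<in> ball (f x) e"
          using c(2) by (auto simp: subset_iff)
        then have "gap_extension f y \<in> ball (f x) e"
          by (rule gap_extension_convex[OF convex_ball])
        then show ?thesis
          by (simp add: dist_commute)
      qed
      then show "eventually (\<lambda>y. dist (gap_extension f y) (f x) < e) (at_right x)"
        unfolding eventually_at_right[OF z(1)] using z(1) by blast
    qed
  qed
qed

text \<open>Mirror image of the limit from the right, now using that a step function is 1 at the
  right end of its gap.\<close>

lemma gap_extension_tendsto_left:
  assumes f: "continuous_on UNIV f" and "x \<in> F"
  shows "(gap_extension f \<longlongrightarrow> f x) (at_left x)"
proof (cases "\<exists>c. c < x")
  case False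
  then have "{..<x} = {}"
    by auto
  then show ?thesis
    by simp
next
  case True
  then obtain c0 where "c0 < x" by auto
  show ?thesis
  proof (cases "\<exists>c<x. {c<..<x} \<inter> F = {}")
    case True
    then obtain c where c: "c < x" "{c<..<x} \<inter> F = {}" by auto
    define b where "b = lo c"
    have "b < x" "b \<in> F"
      using c(1) lo(1,2)[of c] by (auto simp: b_def)
    moreover have "z \<notin> F" if "b < z" "z < x" for z
      using c(2) lo(3)[of z c] that by (cases "c < z") (auto simp: b_def disjoint_iff not_less)
    ultimately have b: "b \<in> F" "b < x" "{b<..<x} \<inter> F = {}"
      by (auto simp: disjoint_iff)
    define g where "g y = f b + apply_bcontfun (step_function b x) y * (f x - f b)" for y
    have "continuous_on UNIV g"
      unfolding g_def by (intro continuous_intros) auto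
    then have "(g \<longlongrightarrow> g x) (at_left x)"
      by (auto simp: continuous_on_def intro: tendsto_within_subset)
    moreover have "g x = f x"
      using step_function(4)[OF compact b(2)] by (simp add: g_def)
    moreover have "eventually (\<lambda>y. g y = gap_extension f y) (at_left x)"
      unfolding eventually_at_left[OF b(2)] using b lo_hi_gap[OF b(1) \<open>x \<in> F\<close> b(3)]
      by (intro exI[of _ b]) (simp add: gap_extension_def g_def)
    ultimately show ?thesis
      by (simp add: tendsto_cong)
  next
    case False
    show ?thesis
    proof (rule tendstoI)
      fix e :: real assume "e > 0"
      have "open (f -` ball (f x) e)"
        using f by (simp add: open_vimage)
      then obtain c where c: "c < x" "{c<..x} \<subseteq> f -` ball (f x) e"
        using open_left[OF _ _ \<open>c0 < x\<close>, of "f -` ball (f x) e"] \<open>e > 0\<close> by auto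
      then have "{c<..<x} \<inter> F \<noteq> {}"
        using False by blast
      then obtain z where z: "z < x" "c < z" "z \<in> F"
        by auto
      have "dist (gap_extension f y) (f x) < e" if "z < y" "y < x" for y
      proof -
        have "lo y \<le> x" "c < lo y" "hi y \<le> x" "c < hi y"
          using lo(2)[of y] lo(3)[OF z(3) less_imp_le[OF that(1)]] hi(2)[of y]
            hi(3)[OF \<open>x \<in> F\<close> less_imp_le[OF that(2)]] that z(1,2) by order+
        then have "f (lo y) \<in> ball (f x) e" "f (hi y) \<in> ball (f x) e"
          using c(2) by (auto simp: subset_iff)
        then have "gap_extension f y \<in> ball (f x) e"
          by (rule gap_extension_convex[OF convex_ball])
        then show ?thesis
          by (simp add: dist_commute)
      qed
      then show "eventually (\<lambda>y. dist (gap_extension f y) (f x) < e) (at_left x)"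
        unfolding eventually_at_left[OF z(1)] using z(1) by blast
    qed
  qed
qed

text \<open>On \<open>F\<close> both one-sided limits agree with the value; off \<open>F\<close> the
  neighbours are constant throughout the surrounding gap, which is open.\<close>

lemma gap_extension_continuous:
  assumes f: "continuous_on UNIV f"
  shows "continuous_on UNIV (gap_extension f)"
proof -
  have "isCont (gap_extension f) x" for x
  proof (cases "x \<in> F")
    case True
    then show ?thesis
      using gap_extension_tendsto_left[OF f True] gap_extension_tendsto_right[OF f True]
      unfolding continuous_at_split by (simp add: continuous_within)
  next
    case False
    define g where
      "g y = f (lo x) + apply_bcontfun (step_function (lo x) (hi x)) y * (f (hi x) - f (lo x))" for y
    have "gap_extension f y = g y" if "y \<in> {lo x<..<hi x}" for y
      using lo_hi_gap[OF lo(1) hi(1) lo_hi_notin(2)[OF False] that]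
      by (simp add: gap_extension_def g_def)
    then have "eventually (\<lambda>y. gap_extension f y = g y) (nhds x)"
      using lo_hi_notin(1)[OF False] by (auto simp: eventually_nhds intro!: exI[of _ "{lo x<..<hi x}"])
    moreover have "continuous_on UNIV g"
      unfolding g_def by (intro continuous_intros) auto
    then have "isCont g x"
      by (simp add: continuous_on_eq_continuous_at)
    ultimately show ?thesis
      by (simp add: isCont_cong)
  qed
  then show ?thesis
    by (simp add: continuous_at_imp_continuous_on)
qed

section \<open>The gap operator as a regular projection\<close>

text \<open>Linearity holds because \<open>lo\<close>, \<open>hi\<close> and the step functions do
  not depend on \<open>f\<close>; the bound 1 is convexity of the ball of radius
  \<open>norm f\<close>.\<close>

lift_definition gap_operator :: "('k \<Rightarrow>\<^sub>C real) \<Rightarrow>\<^sub>L ('k \<Rightarrow>\<^sub>C real)" is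
  "\<lambda>f. Bcontfun (gap_extension (apply_bcontfun f))"
proof -
  define E where "E f = Bcontfun (gap_extension (apply_bcontfun f))" for f :: "'k \<Rightarrow>\<^sub>C real"
  have E: "apply_bcontfun (E f) = gap_extension (apply_bcontfun f)" for f
    unfolding E_def by (intro bounded_continuous_on_compact_UNIV compact gap_extension_continuous) auto
  have "bounded_linear E"
  proof (rule bounded_linear_intro[of _ 1])
    show "norm (E f) \<le> norm f * 1" for f
    proof (rule norm_bound)
      show "norm (apply_bcontfun (E f) x) \<le> norm f * 1" for x
        using gap_extension_convex[OF convex_cball[of 0 "norm f"], of "apply_bcontfun f" x]
          norm_bounded[of f] by (simp add: E)
    qed
  qed (auto intro!: bcontfun_eqI simp: E gap_extension_def algebra_simps)
  then show "bounded_linear (\<lambda>f. Bcontfun (gap_extension (apply_bcontfun f)))"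
    unfolding E_def .
qed

lemma gap_operator: "apply_bcontfun (blinfun_apply gap_operator f) x = gap_extension (apply_bcontfun f) x"
  by (simp add: gap_operator.rep_eq bounded_continuous_on_compact_UNIV[OF compact gap_extension_continuous])

text \<open>The extension reads only the values on \<open>F\<close> and leaves these
  unchanged.\<close>

lemma projection_gap_operator: "projection gap_operator"
  unfolding projection_def
proof (intro blinfun_eqI bcontfun_eqI)
  show "apply_bcontfun (blinfun_apply (gap_operator o\<^sub>L gap_operator) f) x
      = apply_bcontfun (blinfun_apply gap_operator f) x" for f x
    unfolding blinfun_apply_blinfun_compose gap_operator[of "blinfun_apply gap_operator f"]
      gap_extension_def[of "apply_bcontfun (blinfun_apply gap_operator f)"]
    by (simp add: gap_operator lo(1) hi(1)) (simp add: gap_extension_def)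
qed

lemma regular_gap_operator: "regular_operator gap_operator"
  unfolding regular_operator_def
proof (intro conjI allI impI)
  show "blinfun_apply gap_operator (const_bcontfun 1) = const_bcontfun 1"
    by (intro bcontfun_eqI) (simp add: gap_operator gap_extension_def const_bcontfun.rep_eq)
  show "0 \<le> apply_bcontfun (blinfun_apply gap_operator f) x" if "\<forall>x. 0 \<le> apply_bcontfun f x" for f x
    using gap_extension_convex[of "{0..}" "apply_bcontfun f" x] that by (simp add: gap_operator)
qed

text \<open>On the range the norm is therefore a supremum over \<open>F\<close>, so distances there
  can be estimated on \<open>F\<close> alone.\<close>

lemma norm_gap_operator_le:
  assumes "\<And>x. x \<in> F \<Longrightarrow> \<bar>apply_bcontfun f x\<bar> \<le> c"
  shows "norm (blinfun_apply gap_operator f) \<le> c"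
proof (rule norm_bound)
  show "norm (apply_bcontfun (blinfun_apply gap_operator f) x) \<le> c" for x
    using gap_extension_convex[OF convex_cball[of 0 c], of "apply_bcontfun f" x] assms lo hi
    by (simp add: gap_operator)
qed

lemma gap_operator_fixed:
  assumes "\<And>a b u v. a \<in> F \<Longrightarrow> b \<in> F \<Longrightarrow> {a<..<b} \<inter> F = {} \<Longrightarrow> {a<..<b} \<noteq> {} \<Longrightarrow>
    u \<in> {a..b} \<Longrightarrow> v \<in> {a..b} \<Longrightarrow> apply_bcontfun f u = apply_bcontfun f v"
  shows "blinfun_apply gap_operator f = f"
proof (rule bcontfun_eqI)
  fix x
  show "apply_bcontfun (blinfun_apply gap_operator f) x = apply_bcontfun f x"
  proof (cases "x \<in> F")
    case False
    note gap = lo_hi_notin[OF False]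
    have "apply_bcontfun f (lo x) = apply_bcontfun f x" "apply_bcontfun f (hi x) = apply_bcontfun f x"
      using gap(1) by (auto intro!: assms[OF lo(1)[of x] hi(1)[of x] gap(2)])
    then show ?thesis
      by (simp add: gap_operator gap_extension_def)
  qed (simp add: gap_operator)
qed

text \<open>The excess of \<open>f\<close> over \<delta> in modulus lives on a compact set off
  \<open>F\<close>, hence in finitely many gaps, where \<open>fin\<close> splits it into pieces
  killed by \<phi>. The rest has norm at most \<delta>.\<close>

lemma functional_vanishing_on_subset:
  fixes \<phi> :: "('k \<Rightarrow>\<^sub>C real) \<Rightarrow>\<^sub>L real"
  assumes gaps: "\<And>a b f. a \<in> F \<Longrightarrow> b \<in> F \<Longrightarrow> {a<..<b} \<inter> F = {} \<Longrightarrow>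
      (\<And>x. x \<notin> {a<..<b} \<Longrightarrow> apply_bcontfun f x = 0) \<Longrightarrow> blinfun_apply \<phi> f = 0"
    and f: "\<And>x. x \<in> F \<Longrightarrow> apply_bcontfun f x = 0"
  shows "blinfun_apply \<phi> f = 0"
proof -
  define \<G> where "\<G> = {{a<..<b} | a b. a \<in> F \<and> b \<in> F \<and> {a<..<b} \<inter> F = {}}"
  have fin: "blinfun_apply \<phi> g = 0"
    if "finite \<H>" "\<H> \<subseteq> \<G>" "\<And>x. x \<in> F \<Longrightarrow> apply_bcontfun g x = 0"
      "\<And>x. x \<notin> \<Union>\<H> \<Longrightarrow> apply_bcontfun g x = 0" for g \<H>
    using that
  proof (induction \<H> arbitrary: g rule: finite_induct)
    case empty
    then have "g = 0"
      by (intro bcontfun_eqI) simp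
    then show ?case
      by simp
  next
    case (insert G \<H>)
    obtain a b where G: "G = {a<..<b}" "a \<in> F" "b \<in> F" "{a<..<b} \<inter> F = {}"
      using insert.prems(1) by (auto simp: \<G>_def)
    \<comment> \<open>The piece of \<open>g\<close> in the gap \<open>G\<close>: it is continuous
      since \<open>g\<close> vanishes at the two end points, which lie in \<open>F\<close>.\<close>
    define h where "h = Bcontfun (\<lambda>x. if x \<in> G then apply_bcontfun g x else 0)"
    have "closure G \<subseteq> {a..b}"
      unfolding G by (intro closure_minimal) auto
    then have "apply_bcontfun g x = 0" if "x \<in> closure G - G" for x
    proof -
      have "x \<in> {a..b}" "x \<notin> {a<..<b}"
        using that \<open>closure G \<subseteq> {a..b}\<close> G by auto
      then have "x = a \<or> x = b"
        by auto
      then show ?thesis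
        using insert.prems(2) G by auto
    qed
    then have h: "apply_bcontfun h x = (if x \<in> G then apply_bcontfun g x else 0)" for x
      unfolding h_def
      by (subst bounded_continuous_on_compact_UNIV[OF compact continuous_on_mult_indicator])
        (auto simp: G)
    have "blinfun_apply \<phi> h = 0"
      using G by (intro gaps[of a b]) (auto simp: h)
    moreover have "blinfun_apply \<phi> (g - h) = 0"
      using insert.prems by (intro insert.IH) (auto simp: h)
    ultimately show ?case
      by (simp add: blinfun.diff_right)
  qed
  have "\<bar>blinfun_apply \<phi> f\<bar> \<le> norm \<phi> * \<delta>" if "\<delta> > 0" for \<delta>
  proof -
    \<comment> \<open>Soft thresholding again: \<open>g\<close> is within \<delta> of
      \<open>f\<close> and vanishes off the compact set \<open>C\<close>.\<close>
    define g where "g = Bcontfun (\<lambda>x. apply_bcontfun f x - max (- \<delta>) (min \<delta> (apply_bcontfun f x)))"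
    have g: "apply_bcontfun g x = apply_bcontfun f x - max (- \<delta>) (min \<delta> (apply_bcontfun f x))" for x
      unfolding g_def
      by (subst bounded_continuous_on_compact_UNIV[OF compact]) (auto intro!: continuous_intros)
    define C where "C = {x. \<delta> \<le> \<bar>apply_bcontfun f x\<bar>}"
    have "closed C"
      unfolding C_def by (intro closed_Collect_le continuous_intros) auto
    then have "compact C"
      using compact closed_Int_compact[of C UNIV] by simp
    moreover have "C \<subseteq> \<Union>\<G>"
    proof
      fix x assume "x \<in> C"
      then have "x \<notin> F"
        using f \<open>\<delta> > 0\<close> by (auto simp: C_def)
      from lo_hi_notin[OF this] show "x \<in> \<Union>\<G>"
        unfolding \<G>_def using lo(1) hi(1) by blast
    qed
    moreover have "\<forall>G\<in>\<G>. open G"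
      by (auto simp: \<G>_def)
    ultimately obtain \<H> where \<H>: "\<H> \<subseteq> \<G>" "finite \<H>" "C \<subseteq> \<Union>\<H>"
      by (metis compactE)
    have "blinfun_apply \<phi> g = 0"
    proof (rule fin[OF \<H>(2,1)])
      show "apply_bcontfun g x = 0" if "x \<in> F" for x
        using f[OF that] \<open>\<delta> > 0\<close> by (simp add: g)
      show "apply_bcontfun g x = 0" if "x \<notin> \<Union>\<H>" for x
      proof -
        have "\<bar>apply_bcontfun f x\<bar> < \<delta>"
          using subsetD[OF \<H>(3), of x] that by (auto simp: C_def not_le[symmetric])
        then show ?thesis
          by (auto simp: g max_def min_def)
      qed
    qed
    moreover have "norm (f - g) \<le> \<delta>"
    proof (rule norm_bound)
      show "norm (apply_bcontfun (f - g) x) \<le> \<delta>" for x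
        using \<open>\<delta> > 0\<close> by (auto simp: g max_def min_def)
    qed
    then have "\<bar>blinfun_apply \<phi> (f - g)\<bar> \<le> norm \<phi> * \<delta>"
      using norm_blinfun[of \<phi> "f - g"] mult_left_mono[of "norm (f - g)" \<delta> "norm \<phi>"] by simp
    ultimately show ?thesis
      by (simp add: blinfun.diff_right)
  qed
  note le = this
  have "\<bar>blinfun_apply \<phi> f\<bar> \<le> 0"
  proof (rule field_le_epsilon)
    fix e :: real assume "e > 0"
    have "0 < 1 + norm \<phi>"
      using norm_ge_zero[of \<phi>] by linarith
    then have "norm \<phi> * (e / (norm \<phi> + 1)) \<le> e"
      using \<open>e > 0\<close> by (simp add: field_simps)
    with le[of "e / (norm \<phi> + 1)"] \<open>e > 0\<close> show "\<bar>blinfun_apply \<phi> f\<bar> \<le> 0 + e"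
      by (smt (verit) divide_pos_pos norm_ge_zero)
  qed
  then show ?thesis
    by simp
qed

text \<open>\<open>f\<close> and its image agree on \<open>F\<close>, so their difference is
  invisible to \<phi>.\<close>

lemma dual_gap_operator_fixed:
  fixes \<phi> :: "('k \<Rightarrow>\<^sub>C real) \<Rightarrow>\<^sub>L real"
  assumes "\<And>a b f. a \<in> F \<Longrightarrow> b \<in> F \<Longrightarrow> {a<..<b} \<inter> F = {} \<Longrightarrow>
      (\<And>x. x \<notin> {a<..<b} \<Longrightarrow> apply_bcontfun f x = 0) \<Longrightarrow> blinfun_apply \<phi> f = 0"
  shows "dual_operator gap_operator \<phi> = \<phi>"
proof (rule blinfun_eqI)
  fix f
  have "blinfun_apply \<phi> (blinfun_apply gap_operator f - f) = 0"
    by (rule functional_vanishing_on_subset[OF assms]) (auto simp: gap_operator)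
  then show "blinfun_apply (dual_operator gap_operator \<phi>) f = blinfun_apply \<phi> f"
    by (simp add: dual_operator_def blinfun.diff_right)
qed

text \<open>Elements of the range are determined by their values on \<open>F\<close>, where
  compactness and a countable basis leave only countably many finite descriptions up to the error
  \<open>e\<close>.\<close>

lemma separable_range_gap_operator:
  assumes "second_countable (top_of_set F)"
  shows "separable_space (top_of_set (range (blinfun_apply gap_operator)))"
proof (rule separable_space_countable_cover)
  fix e :: real assume "e > 0"
  obtain \<B> where \<B>: "countable \<B>" "\<And>U x. openin (top_of_set F) U \<Longrightarrow> x \<in> U \<Longrightarrow> \<exists>V\<in>\<B>. x \<in> V \<and> V \<subseteq> U"
      "\<And>V. V \<in> \<B> \<Longrightarrow> openin (top_of_set F) V"
    using assms unfolding second_countable_def by metis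
  text \<open>A finite set of pairs \<open>(V, q)\<close> encodes the functions that are close to \<open>q\<close> on \<open>V\<close>.\<close>
  define near where "near c = {g :: 'k \<Rightarrow>\<^sub>C real. \<forall>(V, q)\<in>c. \<forall>y\<in>V. \<bar>apply_bcontfun g y - q\<bar> < e / 4}"
    for c :: "('k set \<times> real) set"
  define codes :: "('k set \<times> real) set set" where "codes = {c. finite c \<and> c \<subseteq> \<B> \<times> \<rat> \<and> F \<subseteq> \<Union>(fst ` c)}"
  have "countable {c :: ('k set \<times> real) set. finite c \<and> c \<subseteq> \<B> \<times> \<rat>}"
    by (intro countable_Collect_finite_subset countable_SIGMA \<B>(1) countable_rat)
  then have "countable codes"
    by (rule countable_subset[rotated]) (auto simp: codes_def)
  show "\<exists>\<C>. countable \<C> \<and> range (blinfun_apply gap_operator) \<subseteq> \<Union>\<C> \<and>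
      (\<forall>C\<in>\<C>. \<forall>x\<in>C \<inter> range (blinfun_apply gap_operator). \<forall>y\<in>C \<inter> range (blinfun_apply gap_operator). dist x y < e)"
  proof (intro exI[of _ "near ` codes"] conjI subsetI ballI)
    show "countable (near ` codes)"
      using \<open>countable codes\<close> by simp
  next
    fix g assume "g \<in> range (blinfun_apply gap_operator)"
    have "\<exists>V q. V \<in> \<B> \<and> q \<in> \<rat> \<and> x \<in> V \<and> (\<forall>y\<in>V. \<bar>apply_bcontfun g y - q\<bar> < e / 4)" if "x \<in> F" for x
    proof -
      obtain q where q: "q \<in> \<rat>" "apply_bcontfun g x - e / 4 < q" "q < apply_bcontfun g x + e / 4"
        using Rats_dense_in_real[of "apply_bcontfun g x - e / 4" "apply_bcontfun g x + e / 4"] \<open>e > 0\<close> by auto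
      have "open {y. \<bar>apply_bcontfun g y - q\<bar> < e / 4}"
        by (intro open_Collect_less continuous_intros) auto
      then have "openin (top_of_set F) (F \<inter> {y. \<bar>apply_bcontfun g y - q\<bar> < e / 4})"
        by blast
      moreover have "x \<in> F \<inter> {y. \<bar>apply_bcontfun g y - q\<bar> < e / 4}"
        using abs_diff_less_iff[of "apply_bcontfun g x" q "e / 4"] q that by auto
      ultimately obtain V where "V \<in> \<B>" "x \<in> V" "V \<subseteq> F \<inter> {y. \<bar>apply_bcontfun g y - q\<bar> < e / 4}"
        using \<B>(2) by metis
      then show ?thesis
        using q(1) by (intro exI[of _ V] exI[of _ q]) auto
    qed
    then obtain V q where Vq: "\<And>x. x \<in> F \<Longrightarrow> V x \<in> \<B>" "\<And>x. x \<in> F \<Longrightarrow> q x \<in> \<rat>" "\<And>x. x \<in> F \<Longrightarrow> x \<in> V x"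
        "\<And>x y. x \<in> F \<Longrightarrow> y \<in> V x \<Longrightarrow> \<bar>apply_bcontfun g y - q x\<bar> < e / 4"
      by metis
    have "compact F"
      using compact_Int_closed_set[of UNIV] by simp
    \<comment> \<open>Basis sets are open only relative to \<open>F\<close>; compactness is applied
      to open sets of the line that trace them.\<close>
    moreover have "\<exists>O'. open O' \<and> V x = F \<inter> O'" if "x \<in> F" for x
      using \<B>(3)[OF Vq(1)[OF that]] by (simp add: openin_open)
    then obtain O' where O': "\<And>x. x \<in> F \<Longrightarrow> open (O' x)" "\<And>x. x \<in> F \<Longrightarrow> V x = F \<inter> O' x"
      by metis
    moreover have "F \<subseteq> (\<Union>x\<in>F. O' x)"
      using O'(2) Vq(3) by blast
    ultimately obtain T where T: "T \<subseteq> F" "finite T" "F \<subseteq> (\<Union>x\<in>T. O' x)"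
      by (metis compactE_image)
    then have "F \<subseteq> (\<Union>x\<in>T. V x)"
      using O'(2) by blast
    then have "(\<lambda>x. (V x, q x)) ` T \<in> codes"
      using Vq T by (auto simp: codes_def image_image)
    moreover have "g \<in> near ((\<lambda>x. (V x, q x)) ` T)"
      using Vq(4) T(1) by (auto simp: near_def)
    ultimately show "g \<in> \<Union>(near ` codes)"
      by blast
  next
    fix C g h
    assume "C \<in> near ` codes" and g: "g \<in> C \<inter> range (blinfun_apply gap_operator)"
      and h: "h \<in> C \<inter> range (blinfun_apply gap_operator)"
    then obtain c where c: "c \<in> codes" "C = near c"
      by auto
    have fixed: "blinfun_apply gap_operator u = u" if "u \<in> range (blinfun_apply gap_operator)" for u
      using that projection_gap_operator unfolding projection_def by (metis blinfun_apply_blinfun_compose imageE)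
    \<comment> \<open>Two functions with a common code differ by at most \<open>e / 2\<close> on
      \<open>F\<close>, and on the range this bounds the norm.\<close>
    have "norm (blinfun_apply gap_operator (g - h)) \<le> e / 2"
    proof (rule norm_gap_operator_le)
      fix x assume "x \<in> F"
      then have "x \<in> \<Union>(fst ` c)"
        using c by (auto simp: codes_def)
      then obtain V q where "(V, q) \<in> c" "x \<in> V"
        by auto
      then have "\<bar>apply_bcontfun g x - q\<bar> < e / 4" "\<bar>apply_bcontfun h x - q\<bar> < e / 4"
        using g h c by (auto simp: near_def)
      then show "\<bar>apply_bcontfun (g - h) x\<bar> \<le> e / 2"
        unfolding minus_bcontfun.rep_eq by linarith
    qed
    moreover have "blinfun_apply gap_operator (g - h) = g - h"
      unfolding blinfun.diff_right fixed[OF IntD2[OF g]] fixed[OF IntD2[OF h]] ..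
    ultimately show "dist g h < e"
      using \<open>e > 0\<close> by (simp add: dist_norm)
  qed
qed

end

section \<open>Monolithic compact lines have the regular controlled SCP\<close>

lemma metrizable_separable_imp_second_countable:
  assumes "metrizable_space X" "separable_space X"
  shows "second_countable X"
proof -
  obtain M d where Md: "Metric_space M d" "X = Metric_space.mtopology M d"
    using assms(1) by (auto simp: metrizable_space_def)
  interpret Metric_space M d
    by (rule Md)
  obtain C where C: "countable C" "C \<subseteq> M" "X closure_of C = M"
    using assms(2) by (auto simp: separable_space_def Md(2))
  define \<B> where "\<B> = (\<lambda>(a, n). mball a (1 / Suc n)) ` (C \<times> (UNIV :: nat set))"
  have "\<exists>V\<in>\<B>. x \<in> V \<and> V \<subseteq> U" if U: "openin X U" "x \<in> U" for U x
  proof -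
    obtain r where r: "r > 0" "mball x r \<subseteq> U" "x \<in> M"
      using U unfolding Md(2) openin_mtopology by blast
    \<comment> \<open>Half of \<open>r\<close>: one radius leads from \<open>x\<close> to the centre
      \<open>a\<close>, the other from \<open>a\<close> to the points of its ball.\<close>
    obtain n where n: "1 / Suc n < r / 2"
      using nat_approx_posE[of "r / 2"] r(1) by auto
    have "x \<in> X closure_of C"
      using C(3) r(3) by simp
    then obtain a where a: "a \<in> C" "a \<in> mball x (1 / Suc n)"
      unfolding Md(2) metric_closure_of using n by (auto dest!: spec[of _ "1 / Suc n"])
    have "mball a (1 / Suc n) \<subseteq> mball x r"
    proof
      fix y assume y: "y \<in> mball a (1 / Suc n)"
      then show "y \<in> mball x r"
        using triangle[of x a y] a(2) n by auto
    qed
    moreover have "x \<in> mball a (1 / Suc n)"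
      using a(2) by (auto simp: commute)
    ultimately show ?thesis
      using r(2) a(1) unfolding \<B>_def
      by (intro bexI[of _ "mball a (1 / Suc n)"]) auto
  qed
  moreover have "countable \<B>" "\<forall>V\<in>\<B>. openin X V"
    using C(1) by (auto simp: \<B>_def Md(2))
  ultimately show ?thesis
    unfolding second_countable_def by blast
qed

lemma monolithic_imp_regular_controlled_SCP:
  assumes K: "compact (UNIV :: 'k::linorder_topology set)" and mono: "aleph0_monolithic TYPE('k)"
  shows "regular_controlled_SCP TYPE('k)"
  unfolding regular_controlled_SCP_def
proof (intro allI impI)
  fix S :: "('k \<Rightarrow>\<^sub>C real) set" and T :: "(('k \<Rightarrow>\<^sub>C real) \<Rightarrow>\<^sub>L real) set"
  assume "countable S" "countable T"
  define flat where "flat f A \<longleftrightarrow> countable A \<and> (\<forall>a b u v. {a<..<b} \<inter> A = {} \<longrightarrow> {a<..<b} \<noteq> {} \<longrightarrow>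
      u \<in> {a..b} \<longrightarrow> v \<in> {a..b} \<longrightarrow> apply_bcontfun f u = apply_bcontfun f v)"
    for f :: "'k \<Rightarrow>\<^sub>C real" and A
  have "\<exists>A. flat f A" for f
    unfolding flat_def
    by (rule continuous_function_partition[OF K continuous_on_apply_bcontfun[of UNIV f]]) blast
  then obtain A where "\<And>f. flat f (A f)"
    by metis
  then have A: "countable (A f)" "\<And>a b u v. {a<..<b} \<inter> A f = {} \<Longrightarrow> {a<..<b} \<noteq> {} \<Longrightarrow>
      u \<in> {a..b} \<Longrightarrow> v \<in> {a..b} \<Longrightarrow> apply_bcontfun f u = apply_bcontfun f v" for f
    unfolding flat_def by blast+
  define null where "null \<phi> B \<longleftrightarrow> countable B \<and> (\<forall>a b f. {a<..<b} \<inter> B = {} \<longrightarrow>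
      (\<forall>x. x \<notin> {a<..<b} \<longrightarrow> apply_bcontfun f x = 0) \<longrightarrow> blinfun_apply \<phi> f = 0)"
    for \<phi> :: "('k \<Rightarrow>\<^sub>C real) \<Rightarrow>\<^sub>L real" and B
  have "\<exists>B. null \<phi> B" for \<phi>
    unfolding null_def by (rule functional_partition[OF K, of \<phi>]) blast
  then obtain B where "\<And>\<phi>. null \<phi> (B \<phi>)"
    by metis
  then have B: "countable (B \<phi>)" "\<And>a b f. {a<..<b} \<inter> B \<phi> = {} \<Longrightarrow>
      (\<And>x. x \<notin> {a<..<b} \<Longrightarrow> apply_bcontfun f x = 0) \<Longrightarrow> blinfun_apply \<phi> f = 0" for \<phi>
    unfolding null_def by blast+
  obtain m M :: 'k where mM: "\<And>x. m \<le> x" "\<And>x. x \<le> M"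
    using compact_attains_inf[OF K] compact_attains_sup[OF K] by auto
  \<comment> \<open>Every gap of the closure of \<open>C\<close> misses the exceptional sets of all
    members of \<open>S\<close> and \<open>T\<close>; \<open>m\<close> and \<open>M\<close> supply
    the end points of the line.\<close>
  define C where "C = insert m (insert M ((\<Union>f\<in>S. A f) \<union> (\<Union>\<phi>\<in>T. B \<phi>)))"
  define F where "F = closure C"
  have "C \<subseteq> F"
    by (simp add: F_def closure_subset)
  have "countable C"
    using \<open>countable S\<close> \<open>countable T\<close> A(1) B(1) by (simp add: C_def)
  then have "metrizable_space (top_of_set F)"
    using mono by (auto simp: aleph0_monolithic_def F_def)
  moreover have "separable_space (top_of_set F)"
    unfolding separable_space_def using \<open>countable C\<close> \<open>C \<subseteq> F\<close>
    by (intro exI[of _ C]) (simp add: closure_of_subtopology Int_absorb1, simp add: F_def)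
  ultimately have sc: "second_countable (top_of_set F)"
    by (rule metrizable_separable_imp_second_countable)
  interpret compact_line_subset F
  proof
    show "closed F"
      by (simp add: F_def)
    show "\<exists>m\<in>F. \<forall>x. m \<le> x" "\<exists>m\<in>F. \<forall>x. x \<le> m"
      using mM \<open>C \<subseteq> F\<close> unfolding C_def by blast+
  qed (rule K)
  have "f \<in> range (blinfun_apply gap_operator)" if "f \<in> S" for f
  proof -
    have "A f \<subseteq> F"
      using that \<open>C \<subseteq> F\<close> unfolding C_def by blast
    then have "blinfun_apply gap_operator f = f"
      by (intro gap_operator_fixed A(2)[of _ _ f]) auto
    then show ?thesis
      by (metis rangeI)
  qed
  moreover have "\<phi> \<in> range (dual_operator gap_operator)" if "\<phi> \<in> T" for \<phi>
  proof -
    have "B \<phi> \<subseteq> F"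
      using that \<open>C \<subseteq> F\<close> unfolding C_def by blast
    then have "dual_operator gap_operator \<phi> = \<phi>"
      by (intro dual_gap_operator_fixed B(2)[of _ _ \<phi>]) auto
    then show ?thesis
      by (metis rangeI)
  qed
  ultimately show "\<exists>P. projection P \<and> regular_operator P \<and>
      separable_space (top_of_set (range (blinfun_apply P))) \<and>
      S \<subseteq> range (blinfun_apply P) \<and> T \<subseteq> range (dual_operator P)"
    using projection_gap_operator regular_gap_operator separable_range_gap_operator[OF sc]
    by (intro exI[of _ gap_operator]) blast
qed

section \<open>Jumps\<close>

text \<open>Evaluation at the members of \<open>E\<close> is an injective continuous map into a
  countable product of real lines; on a compact set it is an embedding.\<close>

lemma metrizable_space_separating_functions:
  fixes L :: "'a::topological_space set" and E :: "('a \<Rightarrow>\<^sub>C real) set"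
  assumes "compact L" "countable E"
    and sep: "\<And>x y. x \<in> L \<Longrightarrow> y \<in> L \<Longrightarrow> x \<noteq> y \<Longrightarrow> \<exists>f\<in>E. apply_bcontfun f x \<noteq> apply_bcontfun f y"
  shows "metrizable_space (top_of_set L)"
proof -
  \<comment> \<open>Inserting 0 makes the enumerated set nonempty.\<close>
  define \<Phi> where "\<Phi> x n = apply_bcontfun (from_nat_into (insert 0 E) n) x" for x n
  have "continuous_on L \<Phi>"
    unfolding \<Phi>_def by (intro continuous_on_coordinatewise_then_product) simp
  moreover have "inj_on \<Phi> L"
  proof (rule inj_onI, rule ccontr)
    fix x y assume xy: "x \<in> L" "y \<in> L" "\<Phi> x = \<Phi> y" "x \<noteq> y"
    then obtain f where f: "f \<in> E" "apply_bcontfun f x \<noteq> apply_bcontfun f y"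
      using sep by blast
    moreover obtain n where "f = from_nat_into (insert 0 E) n"
      using from_nat_into_surj[of "insert 0 E" f] f \<open>countable E\<close> by auto
    ultimately show False
      using fun_cong[OF xy(3), of n] by (simp add: \<Phi>_def)
  qed
  ultimately have "embedding_map (top_of_set L) (euclidean :: (nat \<Rightarrow> real) topology) \<Phi>"
    using \<open>compact L\<close> by (intro continuous_imp_embedding_map) (auto simp: compact_space_subtopology)
  from embedding_map_imp_homeomorphic_space[OF this] show ?thesis
    by (simp add: homeomorphic_metrizable_space metrizable_space_subtopology metrizable_space_euclidean)
qed

text \<open>Adjacency is relative to \<open>L\<close>: points of the line outside \<open>L\<close>
  may lie between \<open>a\<close> and \<open>b\<close>.\<close>

definition jumps :: "'k::linorder set \<Rightarrow> ('k \<times> 'k) set" where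
  "jumps L = {(a, b). a \<in> L \<and> b \<in> L \<and> a < b \<and> {a<..<b} \<inter> L = {}}"

lemma jumps_le:
  assumes "s \<in> jumps L" "t \<in> jumps L" "fst s < fst t"
  shows "snd s \<le> fst t"
  using assms by (force simp: jumps_def not_le[symmetric])

lemma inj_on_jumps: "inj_on fst (jumps L)" "inj_on snd (jumps L)"
proof -
  show "inj_on fst (jumps L)"
  proof (rule inj_onI)
    fix s t assume "s \<in> jumps L" "t \<in> jumps L" "fst s = fst t"
    then have "\<not> snd s < snd t" "\<not> snd t < snd s"
      by (auto simp: jumps_def disjoint_iff)
    then show "s = t"
      using \<open>fst s = fst t\<close> by (intro prod_eqI) auto
  qed
  show "inj_on snd (jumps L)"
  proof (rule inj_onI)
    fix s t assume "s \<in> jumps L" "t \<in> jumps L" "snd s = snd t"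
    then have "\<not> fst s < fst t" "\<not> fst t < fst s"
      by (auto simp: jumps_def disjoint_iff)
    then show "s = t"
      using \<open>snd s = snd t\<close> by (intro prod_eqI) auto
  qed
qed

text \<open>The neighbourhood \<open>V\<close> of \<open>fst t\<close> reaches from \<open>U\<close>
  up to \<open>snd t\<close> and meets \<open>A\<close>. A point of \<open>A\<close> in it is
  neither in the jump nor equal to \<open>fst t\<close>, hence lies to the left.\<close>

lemma jump_approach_left:
  fixes A :: "'k::linorder_topology set"
  assumes "t \<in> jumps (closure A)" "fst t \<notin> A" "finite U" "\<And>u. u \<in> U \<Longrightarrow> u < fst t"
  shows "\<exists>x\<in>A. x < fst t \<and> (\<forall>u\<in>U. u < x)"
proof -
  have t: "fst t \<in> closure A" "fst t < snd t" "{fst t<..<snd t} \<inter> closure A = {}"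
    using assms(1) by (auto simp: jumps_def)
  define V where "V = (\<Inter>u\<in>U. {u<..}) \<inter> {..<snd t}"
  have "open V"
    unfolding V_def using \<open>finite U\<close> by (intro open_Int open_INT) auto
  moreover have "fst t \<in> V"
    using assms(4) t(2) by (auto simp: V_def)
  ultimately have "A \<inter> V \<noteq> {}"
    using t(1) open_Int_closure_eq_empty[of V A] by blast
  then obtain x where x: "x \<in> A" "x \<in> V"
    by blast
  then have "x \<notin> {fst t<..<snd t}"
    using t(3) closure_subset[of A] by blast
  then show ?thesis
    using x assms(2) by (intro bexI[of _ x]) (auto simp: V_def not_less order_le_less)
qed

text \<open>Mirror image of \<open>jump_approach_left\<close>.\<close>

lemma jump_approach_right:
  fixes A :: "'k::linorder_topology set"
  assumes "t \<in> jumps (closure A)" "snd t \<notin> A" "finite U" "\<And>u. u \<in> U \<Longrightarrow> snd t < u"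
  shows "\<exists>x\<in>A. snd t < x \<and> (\<forall>u\<in>U. x < u)"
proof -
  have t: "snd t \<in> closure A" "fst t < snd t" "{fst t<..<snd t} \<inter> closure A = {}"
    using assms(1) by (auto simp: jumps_def)
  define V where "V = (\<Inter>u\<in>U. {..<u}) \<inter> {fst t<..}"
  have "open V"
    unfolding V_def using \<open>finite U\<close> by (intro open_Int open_INT) auto
  moreover have "snd t \<in> V"
    using assms(4) t(2) by (auto simp: V_def)
  ultimately have "A \<inter> V \<noteq> {}"
    using t(1) open_Int_closure_eq_empty[of V A] by blast
  then obtain x where x: "x \<in> A" "x \<in> V"
    by blast
  then have "x \<notin> {fst t<..<snd t}"
    using t(3) closure_subset[of A] by blast
  then show ?thesis
    using x assms(2) by (intro bexI[of _ x]) (auto simp: V_def not_less order_le_less)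
qed

text \<open>Two rounds of choices: first each \<open>d t\<close> right of its jump but before all
  later jumps, then each \<open>c t\<close> left of its jump but beyond \<open>d s\<close> for all
  earlier jumps \<open>s\<close>.\<close>

lemma jumps_enclosed_disjointly:
  fixes A :: "'k::linorder_topology set"
  assumes "finite \<Gamma>" and \<Gamma>: "\<And>t. t \<in> \<Gamma> \<Longrightarrow> t \<in> jumps (closure A) \<and> fst t \<notin> A \<and> snd t \<notin> A"
  obtains c d where "\<And>t. t \<in> \<Gamma> \<Longrightarrow> c t \<in> A \<and> d t \<in> A \<and> c t < fst t \<and> snd t < d t"
    "\<And>s t. s \<in> \<Gamma> \<Longrightarrow> t \<in> \<Gamma> \<Longrightarrow> s \<noteq> t \<Longrightarrow> {c s<..<d s} \<inter> {c t<..<d t} = {}"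
proof -
  \<comment> \<open>Two jumps share no end point, because \<open>A\<close> approaches
    \<open>fst t\<close> from the left without containing it.\<close>
  have less: "snd s < fst t" if st: "s \<in> \<Gamma>" "t \<in> \<Gamma>" "fst s < fst t" for s t
  proof -
    obtain x where "x \<in> A" "x < fst t" "fst s < x"
      using jump_approach_left[of t A "{fst s}"] \<Gamma>[OF st(2)] st(3) by auto
    moreover have "x \<notin> {fst s<..<snd s}"
      using \<Gamma>[OF st(1)] \<open>x \<in> A\<close> closure_subset[of A] by (force simp: jumps_def)
    ultimately show ?thesis
      by auto
  qed
  have "\<forall>t\<in>\<Gamma>. \<exists>x. x \<in> A \<and> snd t < x \<and> (\<forall>u\<in>fst ` {s \<in> \<Gamma>. fst t < fst s}. x < u)"
  proof
    fix t assume "t \<in> \<Gamma>"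
    then have "snd t < u" if "u \<in> fst ` {s \<in> \<Gamma>. fst t < fst s}" for u
      using less that by blast
    then have "\<exists>x\<in>A. snd t < x \<and> (\<forall>u\<in>fst ` {s \<in> \<Gamma>. fst t < fst s}. x < u)"
      using \<Gamma>[OF \<open>t \<in> \<Gamma>\<close>] \<open>finite \<Gamma>\<close> by (intro jump_approach_right) simp_all
    then show "\<exists>x. x \<in> A \<and> snd t < x \<and> (\<forall>u\<in>fst ` {s \<in> \<Gamma>. fst t < fst s}. x < u)"
      by blast
  qed
  from bchoice[OF this] obtain d where
    "\<forall>t\<in>\<Gamma>. d t \<in> A \<and> snd t < d t \<and> (\<forall>u\<in>fst ` {s \<in> \<Gamma>. fst t < fst s}. d t < u)"
    by blast
  then have d: "\<And>t. t \<in> \<Gamma> \<Longrightarrow> d t \<in> A" "\<And>t. t \<in> \<Gamma> \<Longrightarrow> snd t < d t"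
      "\<And>s t. s \<in> \<Gamma> \<Longrightarrow> t \<in> \<Gamma> \<Longrightarrow> fst s < fst t \<Longrightarrow> d s < fst t"
    by blast+
  have "\<forall>t\<in>\<Gamma>. \<exists>x. x \<in> A \<and> x < fst t \<and> (\<forall>u\<in>d ` {s \<in> \<Gamma>. fst s < fst t}. u < x)"
  proof
    fix t assume "t \<in> \<Gamma>"
    then have "u < fst t" if "u \<in> d ` {s \<in> \<Gamma>. fst s < fst t}" for u
      using d(3) that by blast
    then have "\<exists>x\<in>A. x < fst t \<and> (\<forall>u\<in>d ` {s \<in> \<Gamma>. fst s < fst t}. u < x)"
    proof (rule jump_approach_left[rotated -1])
      show "t \<in> jumps (closure A)" "fst t \<notin> A" "finite (d ` {s \<in> \<Gamma>. fst s < fst t})"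
        using \<Gamma>[OF \<open>t \<in> \<Gamma>\<close>] \<open>finite \<Gamma>\<close> by auto
    qed
    then show "\<exists>x. x \<in> A \<and> x < fst t \<and> (\<forall>u\<in>d ` {s \<in> \<Gamma>. fst s < fst t}. u < x)"
      by blast
  qed
  from bchoice[OF this] obtain c where
    "\<forall>t\<in>\<Gamma>. c t \<in> A \<and> c t < fst t \<and> (\<forall>u\<in>d ` {s \<in> \<Gamma>. fst s < fst t}. u < c t)"
    by blast
  then have c: "\<And>t. t \<in> \<Gamma> \<Longrightarrow> c t \<in> A" "\<And>t. t \<in> \<Gamma> \<Longrightarrow> c t < fst t"
      "\<And>s t. s \<in> \<Gamma> \<Longrightarrow> t \<in> \<Gamma> \<Longrightarrow> fst s < fst t \<Longrightarrow> d s < c t"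
    by blast+
  show thesis
  proof (rule that[of c d])
    show "c t \<in> A \<and> d t \<in> A \<and> c t < fst t \<and> snd t < d t" if "t \<in> \<Gamma>" for t
      using c d that by blast
    fix s t assume st: "s \<in> \<Gamma>" "t \<in> \<Gamma>" "s \<noteq> t"
    then have "fst s \<noteq> fst t"
      using inj_on_jumps(1)[of "closure A"] \<Gamma> by (meson inj_onD)
    then have "d s < c t \<or> d t < c s"
      using c(3) st by (meson neqE)
    then show "{c s<..<d s} \<inter> {c t<..<d t} = {}"
      by (auto simp: disjoint_iff)
  qed
qed

section \<open>The SCP bounds the number of jumps\<close>

lemma norm_sum_disjoint_supports_le:
  fixes g :: "'i \<Rightarrow> ('k::topological_space \<Rightarrow>\<^sub>C real)"
  assumes "finite \<Gamma>" "0 \<le> c" "\<And>t x. t \<in> \<Gamma> \<Longrightarrow> \<bar>apply_bcontfun (g t) x\<bar> \<le> c"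
    "\<And>s t x. s \<in> \<Gamma> \<Longrightarrow> t \<in> \<Gamma> \<Longrightarrow> apply_bcontfun (g s) x \<noteq> 0 \<Longrightarrow> apply_bcontfun (g t) x \<noteq> 0 \<Longrightarrow> s = t"
  shows "norm (sum g \<Gamma>) \<le> c"
proof (rule norm_bound)
  fix x
  have "apply_bcontfun (sum g \<Gamma>) x = (\<Sum>t\<in>\<Gamma>. apply_bcontfun (g t) x)"
    by (induction \<Gamma> rule: infinite_finite_induct) auto
  also have "\<bar>\<dots>\<bar> \<le> c"
  proof (cases "\<exists>t\<in>\<Gamma>. apply_bcontfun (g t) x \<noteq> 0")
    case True
    then obtain t where t: "t \<in> \<Gamma>" "apply_bcontfun (g t) x \<noteq> 0" by blast
    then have "(\<Sum>t\<in>\<Gamma>. apply_bcontfun (g t) x) = (\<Sum>t\<in>{t}. apply_bcontfun (g t) x)"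
      using assms(1,4) by (intro sum.mono_neutral_right) auto
    then show ?thesis
      using assms(3) t by simp
  next
    case False
    then show ?thesis
      using assms(2) by simp
  qed
  finally show "norm (apply_bcontfun (sum g \<Gamma>) x) \<le> c"
    by simp
qed

lemma SCP_imp_countable_jumps:
  fixes A :: "'k::linorder_topology set"
  assumes K: "compact (UNIV :: 'k set)" and SCP: "SCP TYPE('k \<Rightarrow>\<^sub>C real)" and "countable A"
  shows "countable (jumps (closure A))"
proof -
  \<comment> \<open>Jumps with an end in \<open>A\<close> are countable by injectivity of the end
    points; they are added back at the end.\<close>
  define J where "J = {t \<in> jumps (closure A). fst t \<notin> A \<and> snd t \<notin> A}"
  define f where "f t = step_function (fst t) (snd t)" for t :: "'k \<times> 'k"
  \<comment> \<open>The countably many functions that \<open>P\<close> is made to fix.\<close>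
  define S where "S = (\<lambda>(c, d). step_function c d) ` (A \<times> A)"
  have "countable S"
    using \<open>countable A\<close> by (simp add: S_def)
  then obtain P :: "('k \<Rightarrow>\<^sub>C real) \<Rightarrow>\<^sub>L ('k \<Rightarrow>\<^sub>C real)" where P: "projection P" "S \<subseteq> range (blinfun_apply P)"
      "separable_space (top_of_set (range (blinfun_apply P)))"
    using SCP by (auto simp: SCP_def)
  have fixed: "blinfun_apply P h = h" if "h \<in> range (blinfun_apply P)" for h
    using P(1) that unfolding projection_def by (metis blinfun_apply_blinfun_compose imageE)
  \<comment> \<open>The defect of \<open>P\<close> at the point \<open>p\<close>: a bounded linear
    functional that vanishes on \<open>S\<close>.\<close>
  define \<psi> where "\<psi> p h = apply_bcontfun (h - blinfun_apply P h) p" for p h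
  have \<psi>_sum: "\<psi> p (\<Sum>t\<in>\<Gamma>. h t) = (\<Sum>t\<in>\<Gamma>. \<psi> p (h t))" for p h and \<Gamma> :: "('k \<times> 'k) set"
    by (induction \<Gamma> rule: infinite_finite_induct)
      (simp_all add: \<psi>_def blinfun.add_right blinfun.zero_right)
  have \<psi>_le: "\<bar>\<psi> p h\<bar> \<le> (1 + norm P) * norm h" for p h
  proof -
    have "\<bar>\<psi> p h\<bar> \<le> norm (h - blinfun_apply P h)"
      using norm_bounded[of "h - blinfun_apply P h" p] by (simp add: \<psi>_def)
    also have "\<dots> \<le> norm h + norm (blinfun_apply P h)"
      by (rule norm_triangle_ineq4)
    also have "\<dots> \<le> norm h + norm P * norm h"
      using norm_blinfun[of P h] by simp
    finally show ?thesis
      by (simp add: algebra_simps)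
  qed
  \<comment> \<open>The \<open>c_0\<close> estimate: subtracting from each \<open>f t\<close> a
    member of \<open>S\<close> that steps across an enclosing interval gives disjointly supported
    functions bounded by 1 and does not change \<psi>.\<close>
  have sum_le: "\<bar>\<Sum>t\<in>\<Gamma>. \<psi> p (f t)\<bar> \<le> 1 + norm P" if "finite \<Gamma>" "\<Gamma> \<subseteq> J" for \<Gamma> p
  proof -
    have \<Gamma>: "t \<in> jumps (closure A) \<and> fst t \<notin> A \<and> snd t \<notin> A" if "t \<in> \<Gamma>" for t
      using \<open>\<Gamma> \<subseteq> J\<close> that by (auto simp: J_def)
    obtain c d where cd: "\<And>t. t \<in> \<Gamma> \<Longrightarrow> c t \<in> A \<and> d t \<in> A \<and> c t < fst t \<and> snd t < d t"
      "\<And>s t. s \<in> \<Gamma> \<Longrightarrow> t \<in> \<Gamma> \<Longrightarrow> s \<noteq> t \<Longrightarrow> {c s<..<d s} \<inter> {c t<..<d t} = {}"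
      using jumps_enclosed_disjointly[OF \<open>finite \<Gamma>\<close> \<Gamma>] by metis
    define g where "g t = f t - step_function (c t) (d t)" for t
    have lt: "fst t < snd t" "c t < d t" if "t \<in> \<Gamma>" for t
    proof -
      show "fst t < snd t"
        using \<Gamma>[OF that] by (auto simp: jumps_def)
      then show "c t < d t"
        using cd(1)[OF that] by auto
    qed
    have \<psi>_step: "\<psi> p (step_function (c t) (d t)) = 0" if "t \<in> \<Gamma>" for t
      using fixed[of "step_function (c t) (d t)"] P(2) cd(1)[OF that]
      by (auto simp: \<psi>_def S_def subset_iff)
    have "\<psi> p (g t) = \<psi> p (f t)" if "t \<in> \<Gamma>" for t
      using \<psi>_step[OF that] by (simp add: \<psi>_def g_def blinfun.diff_right)
    then have "(\<Sum>t\<in>\<Gamma>. \<psi> p (f t)) = \<psi> p (\<Sum>t\<in>\<Gamma>. g t)"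
      by (simp add: \<psi>_sum)
    moreover have "norm (\<Sum>t\<in>\<Gamma>. g t) \<le> 1"
    proof (rule norm_sum_disjoint_supports_le)
      show "\<bar>apply_bcontfun (g t) x\<bar> \<le> 1" if "t \<in> \<Gamma>" for t x
        using step_function(1,2)[OF K lt(1)[OF that], of x] step_function(1,2)[OF K lt(2)[OF that], of x]
        by (simp add: g_def f_def)
      have supp: "x \<in> {c t<..<d t}" if "t \<in> \<Gamma>" "apply_bcontfun (g t) x \<noteq> 0" for t x
      proof (rule ccontr)
        assume "x \<notin> {c t<..<d t}"
        then have "x \<le> c t \<or> d t \<le> x"
          by auto
        moreover have "x \<le> c t \<Longrightarrow> x \<le> fst t" "d t \<le> x \<Longrightarrow> snd t \<le> x"
          using cd(1)[OF that(1)] by auto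
        ultimately show False
          using that(2) step_function(3,4)[OF K lt(1)[OF that(1)], of x]
            step_function(3,4)[OF K lt(2)[OF that(1)], of x]
          by (auto simp: g_def f_def)
      qed
      show "s = t" if "s \<in> \<Gamma>" "t \<in> \<Gamma>" "apply_bcontfun (g s) x \<noteq> 0" "apply_bcontfun (g t) x \<noteq> 0" for s t x
        using supp[of s x] supp[of t x] cd(2)[of s t] that by blast
    qed (use \<open>finite \<Gamma>\<close> in auto)
    ultimately show ?thesis
      using \<psi>_le[of p "\<Sum>t\<in>\<Gamma>. g t"]
        mult_left_mono[of "norm (\<Sum>t\<in>\<Gamma>. g t)" 1 "1 + norm P"] by simp
  qed
  \<comment> \<open>Values of one sign cannot cancel in the sum; \<sigma> selects the sign.\<close>
  have card_le: "real (card \<Gamma>) * \<epsilon> \<le> 1 + norm P"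
    if "finite \<Gamma>" "\<Gamma> \<subseteq> J" "\<bar>\<sigma>\<bar> = 1" "\<And>t. t \<in> \<Gamma> \<Longrightarrow> \<epsilon> \<le> \<sigma> * \<psi> p (f t)" for \<Gamma> \<epsilon> \<sigma> p
  proof -
    have "real (card \<Gamma>) * \<epsilon> \<le> (\<Sum>t\<in>\<Gamma>. \<sigma> * \<psi> p (f t))"
      using that(4) by (intro sum_bounded_below) auto
    also have "\<dots> = \<sigma> * (\<Sum>t\<in>\<Gamma>. \<psi> p (f t))"
      by (simp add: sum_distrib_left)
    also have "\<dots> \<le> \<bar>\<sigma>\<bar> * \<bar>\<Sum>t\<in>\<Gamma>. \<psi> p (f t)\<bar>"
      by (metis abs_ge_self abs_mult)
    also have "\<dots> \<le> 1 + norm P"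
      using sum_le[OF that(1,2)] that(3) by simp
    finally show ?thesis .
  qed
  have fin: "finite {t \<in> J. \<epsilon> \<le> \<sigma> * \<psi> p (f t)}" if \<epsilon>: "\<epsilon> > 0" and \<sigma>: "\<bar>\<sigma>\<bar> = 1" for \<epsilon> \<sigma> p
  proof (rule ccontr)
    assume inf: "infinite {t \<in> J. \<epsilon> \<le> \<sigma> * \<psi> p (f t)}"
    obtain n where n: "1 + norm P < real n * \<epsilon>"
      using reals_Archimedean3[OF \<epsilon>] by blast
    obtain \<Gamma> where "finite \<Gamma>" "card \<Gamma> = n" "\<Gamma> \<subseteq> {t \<in> J. \<epsilon> \<le> \<sigma> * \<psi> p (f t)}"
      using infinite_arbitrarily_large[OF inf] by blast
    then have "real n * \<epsilon> \<le> 1 + norm P"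
      using card_le[of \<Gamma> \<sigma> \<epsilon> p] \<sigma> by blast
    then show False
      using n by simp
  qed
  have count: "countable {t \<in> J. \<psi> p (f t) \<noteq> 0}" for p
  proof -
    have "finite {t \<in> J. 1 / Suc n \<le> 1 * \<psi> p (f t)}" "finite {t \<in> J. 1 / Suc n \<le> - 1 * \<psi> p (f t)}" for n
      by (rule fin; simp)+
    then have "countable (\<Union>n. {t \<in> J. 1 / Suc n \<le> 1 * \<psi> p (f t)} \<union> {t \<in> J. 1 / Suc n \<le> - 1 * \<psi> p (f t)})"
      by (intro countable_UN countable_Un) (simp_all add: countable_finite)
    moreover have "{t \<in> J. \<psi> p (f t) \<noteq> 0}
        \<subseteq> (\<Union>n. {t \<in> J. 1 / Suc n \<le> 1 * \<psi> p (f t)} \<union> {t \<in> J. 1 / Suc n \<le> - 1 * \<psi> p (f t)})"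
    proof
      fix t assume t: "t \<in> {t \<in> J. \<psi> p (f t) \<noteq> 0}"
      then obtain n where "1 / Suc n < \<bar>\<psi> p (f t)\<bar>"
        using nat_approx_posE[of "\<bar>\<psi> p (f t)\<bar>"] by auto
      then have "1 / Suc n \<le> 1 * \<psi> p (f t) \<or> 1 / Suc n \<le> - 1 * \<psi> p (f t)"
        by linarith
      then show "t \<in> (\<Union>n. {t \<in> J. 1 / Suc n \<le> 1 * \<psi> p (f t)} \<union> {t \<in> J. 1 / Suc n \<le> - 1 * \<psi> p (f t)})"
        using t by blast
    qed
    ultimately show ?thesis
      by (rule countable_subset[rotated])
  qed
  \<comment> \<open>For these jumps \<open>P\<close> does not alter \<open>f t\<close> at any point
    of \<open>A\<close>, hence, by continuity, at any point of \<open>closure A\<close>.\<close>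
  define J1 where "J1 = J - (\<Union>p\<in>A. {t \<in> J. \<psi> p (f t) \<noteq> 0})"
  have eq: "apply_bcontfun (blinfun_apply P (f t)) x = apply_bcontfun (f t) x" if "t \<in> J1" "x \<in> closure A" for t x
  proof -
    define Z where "Z = {x. apply_bcontfun (blinfun_apply P (f t)) x = apply_bcontfun (f t) x}"
    have "closed Z"
      unfolding Z_def by (intro closed_Collect_eq) auto
    moreover have "A \<subseteq> Z"
      using that(1) by (auto simp: J1_def \<psi>_def Z_def)
    ultimately have "closure A \<subseteq> Z"
      by (intro closure_minimal)
    then show ?thesis
      using that(2) by (auto simp: Z_def)
  qed
  \<comment> \<open>The left end of the later jump separates the two functions: there
    \<open>f s\<close> is 1 and \<open>f t\<close> is 0.\<close>
  have apart: "1 \<le> dist (blinfun_apply P (f s)) (blinfun_apply P (f t))"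
    if "s \<in> J1" "t \<in> J1" "fst s < fst t" for s t
  proof -
    have st: "s \<in> jumps (closure A)" "t \<in> jumps (closure A)"
      using that by (auto simp: J1_def J_def)
    then have lt: "fst s < snd s" "fst t < snd t" and mem: "fst t \<in> closure A"
      by (auto simp: jumps_def)
    have "apply_bcontfun (f s) (fst t) = 1" "apply_bcontfun (f t) (fst t) = 0"
      using step_function(4)[OF K lt(1) jumps_le[OF st that(3)]] step_function(3)[OF K lt(2), of "fst t"]
      by (simp_all add: f_def)
    then have "1 = dist (apply_bcontfun (blinfun_apply P (f s)) (fst t)) (apply_bcontfun (blinfun_apply P (f t)) (fst t))"
      using eq[OF that(1) mem] eq[OF that(2) mem] by (simp add: dist_real_def)
    also have "\<dots> \<le> dist (blinfun_apply P (f s)) (blinfun_apply P (f t))"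
      by (rule dist_bounded)
    finally show ?thesis .
  qed
  obtain C where C: "countable C" "C \<subseteq> range (blinfun_apply P)" "range (blinfun_apply P) \<subseteq> closure C"
    using P(3) unfolding separable_space_def by (force simp: closure_of_subtopology Int_absorb1)
  \<comment> \<open>Points at mutual distance at least 1 have different approximants within 1/2, so
    the countable set \<open>C\<close> bounds their number.\<close>
  have "\<exists>c\<in>C. dist (blinfun_apply P (f t)) c < 1 / 2" for t
    using C(3) by (intro closure_approachableD) auto
  then obtain c where c: "\<And>t. c t \<in> C" "\<And>t. dist (blinfun_apply P (f t)) (c t) < 1 / 2"
    by metis
  have "inj_on c J1"
  proof (rule inj_onI, rule ccontr)
    fix s t assume st: "s \<in> J1" "t \<in> J1" "c s = c t" "s \<noteq> t"
    then have "fst s \<noteq> fst t"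
      using inj_on_jumps(1)[of "closure A"] by (auto simp: J1_def J_def dest: inj_onD)
    then have "1 \<le> dist (blinfun_apply P (f s)) (blinfun_apply P (f t))"
      using apart[of s t] apart[of t s] st by (auto simp: dist_commute neq_iff)
    moreover have "dist (blinfun_apply P (f s)) (blinfun_apply P (f t)) < 1 / 2 + 1 / 2"
      using c(2)[of s] c(2)[of t] st(3) by (intro dist_triangle_less_add[of _ "c s"]) (auto simp: dist_commute)
    ultimately show False
      by simp
  qed
  moreover have "countable (c ` J1)"
    using c(1) C(1) by (meson countable_subset image_subsetI)
  ultimately have J1: "countable J1"
    by (rule countable_image_inj_on[rotated])
  have exceptional: "countable (\<Union>p\<in>A. {t \<in> J. \<psi> p (f t) \<noteq> 0})"
    using \<open>countable A\<close> count by (rule countable_UN)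
  have left: "countable {t \<in> jumps (closure A). fst t \<in> A}"
    by (rule countable_image_inj_on[of fst, OF countable_subset[OF _ \<open>countable A\<close>]])
      (auto intro: inj_on_subset[OF inj_on_jumps(1)])
  have right: "countable {t \<in> jumps (closure A). snd t \<in> A}"
    by (rule countable_image_inj_on[of snd, OF countable_subset[OF _ \<open>countable A\<close>]])
      (auto intro: inj_on_subset[OF inj_on_jumps(2)])
  have "jumps (closure A) \<subseteq> J1 \<union> (\<Union>p\<in>A. {t \<in> J. \<psi> p (f t) \<noteq> 0}) \<union>
      {t \<in> jumps (closure A). fst t \<in> A} \<union> {t \<in> jumps (closure A). snd t \<in> A}"
    by (auto simp: J1_def J_def)
  then show ?thesis
    by (rule countable_subset) (intro countable_Un J1 exceptional left right)
qed

text \<open>By compactness it suffices to separate the points of \<open>L\<close> by countably many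
  functions. Step functions between points of \<open>A\<close> and ends of jumps do so, and the SCP
  makes the jumps countable.\<close>

lemma SCP_imp_monolithic:
  assumes K: "compact (UNIV :: 'k::linorder_topology set)" and SCP: "SCP TYPE('k \<Rightarrow>\<^sub>C real)"
  shows "aleph0_monolithic TYPE('k)"
  unfolding aleph0_monolithic_def
proof (intro allI impI)
  fix A :: "'k set"
  assume "countable A"
  define L where "L = closure A"
  define D where "D = A \<union> fst ` jumps L \<union> snd ` jumps L"
  have "countable D"
    using \<open>countable A\<close> SCP_imp_countable_jumps[OF K SCP \<open>countable A\<close>] by (simp add: D_def L_def)
  define E where "E = (\<lambda>(c, d). step_function c d) ` (D \<times> D)"
  have "compact L"
    using K closed_Int_compact[of L UNIV] by (simp add: L_def)
  have "metrizable_space (top_of_set L)"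
  proof (rule metrizable_space_separating_functions[OF \<open>compact L\<close>])
    show "countable E"
      using \<open>countable D\<close> by (simp add: E_def)
    have jump: "x \<in> D \<and> y \<in> D" if "x \<in> L" "y \<in> L" "x < y" "{x<..<y} \<inter> L = {}" for x y
    proof -
      have "(x, y) \<in> jumps L"
        using that by (simp add: jumps_def)
      then show ?thesis
        unfolding D_def by (metis UnCI fst_conv imageI snd_conv)
    qed
    have inA: "\<exists>z\<in>A. x < z \<and> z < y" if "{x<..<y} \<inter> L \<noteq> {}" for x y
      using that open_Int_closure_eq_empty[of "{x<..<y}" A] by (auto simp: L_def)
    have "A \<subseteq> L" "A \<subseteq> D"
      by (auto simp: L_def D_def closure_subset)
    \<comment> \<open>Two points of \<open>D\<close> are sought in \<open>[x, y]\<close>. A point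
      \<open>c\<close> of \<open>A\<close> strictly between is followed either by another point of
      \<open>A\<close> or by the jump from \<open>c\<close> to \<open>y\<close>.\<close>
    have dense: "\<exists>c\<in>D. \<exists>d\<in>D. x \<le> c \<and> c < d \<and> d \<le> y" if xy: "x \<in> L" "y \<in> L" "x < y" for x y
    proof (cases "{x<..<y} \<inter> L = {}")
      case True
      then show ?thesis
        using jump[OF xy] xy by blast
    next
      case False
      then obtain c where c: "c \<in> A" "x < c" "c < y"
        using inA by blast
      show ?thesis
      proof (cases "{c<..<y} \<inter> L = {}")
        case True
        then show ?thesis
          using jump[of c y] c xy \<open>A \<subseteq> L\<close> by (intro bexI[of _ c] bexI[of _ y]) auto
      next
        case False
        then obtain d where "d \<in> A" "c < d" "d < y"
          using inA by blast
        then show ?thesis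
          using c \<open>A \<subseteq> D\<close> by (intro bexI[of _ c] bexI[of _ d]) auto
      qed
    qed
    have sep: "\<exists>f\<in>E. apply_bcontfun f x \<noteq> apply_bcontfun f y" if xy: "x \<in> L" "y \<in> L" "x < y" for x y
    proof -
      obtain c d where cd: "c \<in> D" "d \<in> D" "x \<le> c" "c < d" "d \<le> y"
        using dense[OF xy] by blast
      then have "apply_bcontfun (step_function c d) x = 0" "apply_bcontfun (step_function c d) y = 1"
        using step_function(3,4)[OF K cd(4)] by auto
      then show ?thesis
        using cd(1,2) by (intro bexI[of _ "step_function c d"]) (auto simp: E_def)
    qed
    show "\<exists>f\<in>E. apply_bcontfun f x \<noteq> apply_bcontfun f y" if "x \<in> L" "y \<in> L" "x \<noteq> y" for x y
      using sep[of x y] sep[of y x] that by (metis neqE)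
  qed
  then show "metrizable_space (top_of_set (closure A))"
    by (simp add: L_def)
qed

theorem theorem1p6:
  assumes "compact (UNIV :: 'k::linorder_topology set)"
  shows "(regular_controlled_SCP TYPE('k) \<longleftrightarrow> controlled_SCP TYPE('k \<Rightarrow>\<^sub>C real)) \<and>
         (controlled_SCP TYPE('k \<Rightarrow>\<^sub>C real) \<longleftrightarrow> SCP TYPE('k \<Rightarrow>\<^sub>C real)) \<and>
         (SCP TYPE('k \<Rightarrow>\<^sub>C real) \<longleftrightarrow> aleph0_monolithic TYPE('k))"
proof -
  \<comment> \<open>From (a) to (b) regularity is forgotten, from (b) to (c) \<open>T\<close> is
    taken empty; the two remaining implications close the cycle.\<close>
  have "regular_controlled_SCP TYPE('k) \<Longrightarrow> controlled_SCP TYPE('k \<Rightarrow>\<^sub>C real)"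
    unfolding regular_controlled_SCP_def controlled_SCP_def by meson
  moreover have "controlled_SCP TYPE('k \<Rightarrow>\<^sub>C real) \<Longrightarrow> SCP TYPE('k \<Rightarrow>\<^sub>C real)"
    unfolding controlled_SCP_def SCP_def by (meson countable_empty)
  ultimately show ?thesis
    using monolithic_imp_regular_controlled_SCP[OF assms] SCP_imp_monolithic[OF assms] by blast
qed

end
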